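(* Let $P=P_1|P_2|\dots|P_k$ be a network of $\pi_a$-calculus processes. Suppose the associated hypergraph $H(P)$ admits an automorphism $\sigma\neq \mathit{id}$ that has exactly one orbit (i.e. $O_\sigma(i)=\{1,\dots,k\}$ for every node $i$), and that $P$ is symmetric with respect to $\sigma$. Then $P$ is not an electoral system.
   Context: Syntax and semantics of the $\pi_a$-calculus: names from a countable set $\mathcal N$ that contains the natural numbers and a distinguished name $o$; processes $P ::= \bar{x}y \mid x(y).P \mid \nu x P \mid P|P \mid !P$, with the standard early labelled transition system of the $\pi$-calculus (rules Out, In, Open, Res, Par, Com, Close, Rep, and closure under structural congruence, which includes alpha-conversion, commutativity and associativity of $|$, and scope extrusion $(\nu xP)|Q\equiv\nu x(P|Q)$ for $x\notin\mathit{fn}(Q)$). Restrictions created by Close are pushed to the top level of the network, and the network never performs a visible action on a name restricted at top level. Network and computation: a network is $P=P_1|\dots|P_k$; a computation $C$ is a finite or $\omega$-infinite sequence of transitions $P=P^0\xrightarrow{\mu^0}P^1\xrightarrow{\mu^1}\cdots$ where each $P^m=P^m_1|\dots|P^m_k$. $C'$ extends $C$ if $C$ is a prefix of $C'$. The projection $\mathit{Proj}(C,P_i)$ is the sequence of the $i$-th components' transitions: at step $m$, if the step is derived by Par from a transition of component $i$ then it contributes that transition; if derived by Com or Close with a premise that is a transition of component $i$, it contributes that premise; if component $i$ is idle it contributes nothing. Electoral system: $P=P_1|\dots|P_k$ is electoral if for every computation $C$ of $P$ there is an extension $C'$ of $C$ and an $n\in\{1,\dots,k\}$ such that for each $i$,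 $\mathit{Proj}(C',P_i)$ contains an output action $\bar{o}n$, and no extension of $C'$ contains any action $\bar{o}m$ with $m\neq n$. Hypergraph: $H=\langle N,X,t\rangle$ with finite sets $N$ (nodes), $X$ (arcs) and $t$ assigning to each arc a set of nodes. The hypergraph of a network is $H(P)=\langle\{1,\dots,k\},\ \mathit{fn}(P)\setminus\{o\},\ t\rangle$ with $t(x)=\{n : x\in \mathit{fn}(P_n)\}$. An automorphism is a pair $\sigma=\langle\sigma_N,\sigma_X\rangle$ of permutations of $N$ and $X$ with $t(\sigma_X(x))=\sigma_N(t(x))$ for all $x$. The orbit of $n$ is $O_\sigma(n)=\{n,\sigma(n),\dots,\sigma^{h-1}(n)\}$ where $\sigma^h=\mathit{id}$. Symmetry: for a process $Q$, $\sigma(Q)$ is obtained by first alpha-renaming bound names to fresh names, then renaming every free name by $\sigma$ (acting as $\sigma_X$ on arcs, as $\sigma_N$ on node identifiers, identity on all other names including $o$ and the fresh bound names), homomorphically on all constructs. $P$ is symmetric with respect to $\sigma$ if $P_{\sigma(i)}\equiv_\alpha \sigma(P_i)$ for every node $i$. *)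

theory Defs
  imports Main "HOL-Library.Extended_Nat" "HOL-Combinatorics.Permutations"
begin

text \<open>Countable set of names: the natural numbers (Num n), the distinguished
  name o (Obs), and infinitely many further names (Nm n).\<close>
datatype name = Num nat | Obs | Nm nat

text \<open>Nil is the inactive process, needed as residual of the Out rule.\<close>
datatype proc =
    Nil
  | Out name name          (* x<y>, asynchronous output *)
  | In name name proc      (* x(y).P, y bound in P *)
  | Res name proc          (* nu x P, x bound in P *)
  | Par proc proc
  | Bang proc

fun fnames :: "proc \<Rightarrow> name set" where
  "fnames Nil = {}"
| "fnames (Out x y) = {x, y}"
| "fnames (In x y P) = insert x (fnames P - {y})"
| "fnames (Res x P) = fnames P - {x}"
| "fnames (Par P Q) = fnames P \<union> fnames Q"
| "fnames (Bang P) = fnames P"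

definition fresh :: "name set \<Rightarrow> name" where
  "fresh S = Nm (LEAST n. Nm n \<notin> S)"

fun ren :: "(name \<Rightarrow> name) \<Rightarrow> proc \<Rightarrow> proc" where
  "ren f Nil = Nil"
| "ren f (Out x y) = Out (f x) (f y)"
| "ren f (In x y P) =
     (let z = fresh (f ` (fnames P - {y})) in In (f x) z (ren (f(y := z)) P))"
| "ren f (Res x P) =
     (let z = fresh (f ` (fnames P - {x})) in Res z (ren (f(x := z)) P))"
| "ren f (Par P Q) = Par (ren f P) (ren f Q)"
| "ren f (Bang P) = Bang (ren f P)"

definition subst1 :: "proc \<Rightarrow> name \<Rightarrow> name \<Rightarrow> proc" where
  "subst1 P z y = ren (id(y := z)) P"

inductive alpha :: "proc \<Rightarrow> proc \<Rightarrow> bool" where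
  a_refl: "alpha P P"
| a_sym: "alpha P Q \<Longrightarrow> alpha Q P"
| a_trans: "alpha P Q \<Longrightarrow> alpha Q R \<Longrightarrow> alpha P R"
| a_In: "z \<notin> fnames P - {y} \<Longrightarrow> alpha (In x y P) (In x z (subst1 P z y))"
| a_Res: "z \<notin> fnames P - {y} \<Longrightarrow> alpha (Res y P) (Res z (subst1 P z y))"
| a_cIn: "alpha P Q \<Longrightarrow> alpha (In x y P) (In x y Q)"
| a_cRes: "alpha P Q \<Longrightarrow> alpha (Res x P) (Res x Q)"
| a_cPar: "alpha P P' \<Longrightarrow> alpha Q Q' \<Longrightarrow> alpha (Par P Q) (Par P' Q')"
| a_cBang: "alpha P Q \<Longrightarrow> alpha (Bang P) (Bang Q)"

inductive scong :: "proc \<Rightarrow> proc \<Rightarrow> bool" where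
  s_alpha: "alpha P Q \<Longrightarrow> scong P Q"
| s_sym: "scong P Q \<Longrightarrow> scong Q P"
| s_trans: "scong P Q \<Longrightarrow> scong Q R \<Longrightarrow> scong P R"
| s_nil: "scong (Par P Nil) P"
| s_comm: "scong (Par P Q) (Par Q P)"
| s_assoc: "scong (Par (Par P Q) R) (Par P (Par Q R))"
| s_extr: "x \<notin> fnames Q \<Longrightarrow> scong (Par (Res x P) Q) (Res x (Par P Q))"
| s_cIn: "scong P Q \<Longrightarrow> scong (In x y P) (In x y Q)"
| s_cRes: "scong P Q \<Longrightarrow> scong (Res x P) (Res x Q)"
| s_cPar: "scong P P' \<Longrightarrow> scong Q Q' \<Longrightarrow> scong (Par P Q) (Par P' Q')"
| s_cBang: "scong P Q \<Longrightarrow> scong (Bang P) (Bang Q)"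

datatype act =
    Tau
  | OutA name name
  | BOutA name name
  | InA name name

fun act_names :: "act \<Rightarrow> name set" where
  "act_names Tau = {}"
| "act_names (OutA x y) = {x, y}"
| "act_names (BOutA x y) = {x, y}"
| "act_names (InA x y) = {x, y}"

fun act_bn :: "act \<Rightarrow> name set" where
  "act_bn (BOutA x y) = {y}"
| "act_bn _ = {}"

inductive trans :: "proc \<Rightarrow> act \<Rightarrow> proc \<Rightarrow> bool" where
  t_Out: "trans (Out x y) (OutA x y) Nil"
| t_In: "trans (In x y P) (InA x z) (subst1 P z y)"
| t_Open: "trans P (OutA x y) P' \<Longrightarrow> x \<noteq> y \<Longrightarrow> trans (Res y P) (BOutA x y) P'"
| t_Res: "trans P \<mu> P' \<Longrightarrow> y \<notin> act_names \<mu> \<Longrightarrow> trans (Res y P) \<mu> (Res y P')"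
| t_Par: "trans P \<mu> P' \<Longrightarrow> act_bn \<mu> \<inter> fnames Q = {} \<Longrightarrow> trans (Par P Q) \<mu> (Par P' Q)"
| t_Com: "trans P (OutA x y) P' \<Longrightarrow> trans Q (InA x y) Q' \<Longrightarrow> trans (Par P Q) Tau (Par P' Q')"
| t_Close: "trans P (BOutA x y) P' \<Longrightarrow> trans Q (InA x y) Q' \<Longrightarrow> y \<notin> fnames Q \<Longrightarrow>
            trans (Par P Q) Tau (Res y (Par P' Q'))"
| t_Rep: "trans (Par P (Bang P)) \<mu> P' \<Longrightarrow> trans (Bang P) \<mu> P'"
| t_Cong: "scong P P1 \<Longrightarrow> trans P1 \<mu> Q1 \<Longrightarrow> scong Q1 Q \<Longrightarrow> trans P \<mu> Q"

text \<open>A network state nu R (P_1 | ... | P_k): the set R of names restricted at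
  top level (created by Close) and the components, indexed by nodes 1..k.\<close>
type_synonym net = "name set \<times> (nat \<Rightarrow> proc)"

text \<open>Network step labels record the derivation: a Par step of component i
  with action mu, or a Com/Close between output component i and input component j
  on channel x with object y.\<close>
datatype nlab = LPar nat act | LCom nat nat name name | LClose nat nat name name

inductive ntrans :: "nat \<Rightarrow> net \<Rightarrow> nlab \<Rightarrow> net \<Rightarrow> bool" for k :: nat where
  n_Par: "i \<in> {1..k} \<Longrightarrow> trans (C i) \<mu> P' \<Longrightarrow> act_names \<mu> \<inter> R = {} \<Longrightarrow>
          (\<forall>j\<in>{1..k} - {i}. act_bn \<mu> \<inter> fnames (C j) = {}) \<Longrightarrow>
          ntrans k (R, C) (LPar i \<mu>) (R, C(i := P'))"
| n_Com: "i \<in> {1..k} \<Longrightarrow> j \<in> {1..k} \<Longrightarrow> i \<noteq> j \<Longrightarrow>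
          trans (C i) (OutA x y) Pi' \<Longrightarrow> trans (C j) (InA x y) Pj' \<Longrightarrow>
          ntrans k (R, C) (LCom i j x y) (R, C(i := Pi', j := Pj'))"
| n_Close: "i \<in> {1..k} \<Longrightarrow> j \<in> {1..k} \<Longrightarrow> i \<noteq> j \<Longrightarrow>
          trans (C i) (BOutA x y) Pi' \<Longrightarrow> trans (C j) (InA x y) Pj' \<Longrightarrow>
          (\<forall>l\<in>{1..k} - {i}. y \<notin> fnames (C l)) \<Longrightarrow> y \<notin> R \<Longrightarrow>
          ntrans k (R, C) (LClose i j x y) (insert y R, C(i := Pi', j := Pj'))"

fun nact :: "nlab \<Rightarrow> act" where
  "nact (LPar i \<mu>) = \<mu>"
| "nact (LCom i j x y) = Tau"
| "nact (LClose i j x y) = Tau"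

fun contrib :: "nat \<Rightarrow> nlab \<Rightarrow> act option" where
  "contrib n (LPar i \<mu>) = (if n = i then Some \<mu> else None)"
| "contrib n (LCom i j x y) =
     (if n = i then Some (OutA x y) else if n = j then Some (InA x y) else None)"
| "contrib n (LClose i j x y) =
     (if n = i then Some (BOutA x y) else if n = j then Some (InA x y) else None)"

text \<open>A computation: states, step labels, and length (finite or infinite).
  Transition m goes from states m to states (m+1) with label labs m, for m < len.\<close>
datatype comp = Comp (states: "nat \<Rightarrow> net") (labs: "nat \<Rightarrow> nlab") (len: enat)

definition is_comp :: "nat \<Rightarrow> net \<Rightarrow> comp \<Rightarrow> bool" where
  "is_comp k N C \<longleftrightarrow> states C 0 = N \<and>
     (\<forall>m. enat m < len C \<longrightarrow> ntrans k (states C m) (labs C m) (states C (Suc m)))"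

definition extends :: "comp \<Rightarrow> comp \<Rightarrow> bool" where
  "extends C C' \<longleftrightarrow> len C \<le> len C' \<and>
     (\<forall>m. enat m \<le> len C \<longrightarrow> states C' m = states C m) \<and>
     (\<forall>m. enat m < len C \<longrightarrow> labs C' m = labs C m)"

definition proj :: "comp \<Rightarrow> nat \<Rightarrow> nat \<Rightarrow> (proc \<times> act \<times> proc) option" where
  "proj C i m = (if enat m < len C then
       (case contrib i (labs C m) of
          None \<Rightarrow> None
        | Some \<mu> \<Rightarrow> Some (snd (states C m) i, \<mu>, snd (states C (Suc m)) i))
     else None)"

definition proj_contains :: "comp \<Rightarrow> nat \<Rightarrow> act \<Rightarrow> bool" where
  "proj_contains C i \<mu> \<longleftrightarrow> (\<exists>m P P'. proj C i m = Some (P, \<mu>, P'))"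

definition comp_contains :: "nat \<Rightarrow> comp \<Rightarrow> act \<Rightarrow> bool" where
  "comp_contains k C \<mu> \<longleftrightarrow>
     (\<exists>m. enat m < len C \<and> nact (labs C m) = \<mu>) \<or> (\<exists>i\<in>{1..k}. proj_contains C i \<mu>)"

definition init_net :: "(nat \<Rightarrow> proc) \<Rightarrow> net" where
  "init_net P = ({}, P)"

definition electoral :: "nat \<Rightarrow> (nat \<Rightarrow> proc) \<Rightarrow> bool" where
  "electoral k P \<longleftrightarrow>
     (\<forall>C. is_comp k (init_net P) C \<longrightarrow>
        (\<exists>C' n. is_comp k (init_net P) C' \<and> extends C C' \<and> n \<in> {1..k} \<and>
           (\<forall>i\<in>{1..k}. proj_contains C' i (OutA Obs (Num n))) \<and>
           (\<forall>C''. is_comp k (init_net P) C'' \<and> extends C' C'' \<longrightarrow>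
              (\<forall>m. m \<noteq> n \<longrightarrow> \<not> comp_contains k C'' (OutA Obs (Num m))))))"

definition hg_arcs :: "nat \<Rightarrow> (nat \<Rightarrow> proc) \<Rightarrow> name set" where
  "hg_arcs k P = (\<Union>i\<in>{1..k}. fnames (P i)) - {Obs}"

definition hg_t :: "nat \<Rightarrow> (nat \<Rightarrow> proc) \<Rightarrow> name \<Rightarrow> nat set" where
  "hg_t k P x = {n \<in> {1..k}. x \<in> fnames (P n)}"

definition hg_automorphism ::
    "nat \<Rightarrow> (nat \<Rightarrow> proc) \<Rightarrow> (nat \<Rightarrow> nat) \<Rightarrow> (name \<Rightarrow> name) \<Rightarrow> bool" where
  "hg_automorphism k P \<sigma>N \<sigma>X \<longleftrightarrow>
     \<sigma>N permutes {1..k} \<and> \<sigma>X permutes hg_arcs k P \<and>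
     (\<forall>x\<in>hg_arcs k P. hg_t k P (\<sigma>X x) = \<sigma>N ` hg_t k P x)"

definition node_orbit :: "(nat \<Rightarrow> nat) \<Rightarrow> nat \<Rightarrow> nat set" where
  "node_orbit \<sigma>N n = {(\<sigma>N ^^ j) n | j. True}"

definition sig_name ::
    "nat \<Rightarrow> (nat \<Rightarrow> proc) \<Rightarrow> (nat \<Rightarrow> nat) \<Rightarrow> (name \<Rightarrow> name) \<Rightarrow> name \<Rightarrow> name" where
  "sig_name k P \<sigma>N \<sigma>X x =
     (case x of
        Num n \<Rightarrow> (if n \<in> {1..k} then Num (\<sigma>N n)
                  else if x \<in> hg_arcs k P then \<sigma>X x else x)
      | _ \<Rightarrow> (if x \<in> hg_arcs k P then \<sigma>X x else x))"

definition sig_proc ::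
    "nat \<Rightarrow> (nat \<Rightarrow> proc) \<Rightarrow> (nat \<Rightarrow> nat) \<Rightarrow> (name \<Rightarrow> name) \<Rightarrow> proc \<Rightarrow> proc" where
  "sig_proc k P \<sigma>N \<sigma>X Q = ren (sig_name k P \<sigma>N \<sigma>X) Q"

definition symmetric_wrt ::
    "nat \<Rightarrow> (nat \<Rightarrow> proc) \<Rightarrow> (nat \<Rightarrow> nat) \<Rightarrow> (name \<Rightarrow> name) \<Rightarrow> bool" where
  "symmetric_wrt k P \<sigma>N \<sigma>X \<longleftrightarrow>
     (\<forall>i\<in>{1..k}. alpha (P (\<sigma>N i)) (sig_proc k P \<sigma>N \<sigma>X (P i)))"

end

theory Submission
  imports Defs "HOL-Combinatorics.Orbits"
begin

text \<open>
  Suppose all nodes of the ring are in states that are images of each other under the symmetry.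
  Whatever step is possible, its \<open>k\<close> images under the symmetry can be performed one after the
  other, and the network is symmetric again. The only problematic case is a communication: every
  node has to send once and receive once, and going around the ring some nodes receive first while
  others send first. Since output is asynchronous, a process that emits \<open>x<y>\<close> is congruent
  to \<open>x<y> | P'\<close> with \<open>P'\<close> the residual, so the two orders lead to congruent states.
  If a node announced the leader \<open>n\<close> in such a round, another one would announce
  \<open>\<sigma> n \<noteq> n\<close>; hence an electoral system stays silent, and iterating rounds for ever gives
  an infinite computation without a leader.

  Congruence here is structural congruence together with exchange of restrictions and unfolding of
  replication. For this relation to be usable it must be a strong bisimulation, which is proved on
  de Bruijn terms, where alpha-equivalent processes are equal.
\<close>

section \<open>De Bruijn terms up to congruence\<close>

text \<open>A renamed process is the same process read through another map from names to indices.
  Symmetric states are therefore related by \<open>sem enc P = sem (enc \<circ> s ^^ m) Q\<close>: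
  the renaming lives in the environment, and the binders that \<open>ren\<close> refreshes never
  have to be tracked. Two difficulties shape the rounds. In the middle of a round a node may have
  performed its output, its input, both or neither; only the state after both has to be independent
  of the order, so a diamond for one output and one input of the same process is enough. The
  permutation is therefore altered beyond all names of the initial network, where it is made to
  rotate blocks of length \<open>k\<close>.\<close>

text \<open>Free names are indices as well: under \<open>n\<close> binders, the global name \<open>m\<close> is the index
  \<open>m + n\<close>.\<close>

datatype dproc =
    DNil
  | DOut nat nat
  | DIn nat dproc
  | DRes dproc
  | DPar dproc dproc
  | DBang dproc

definition up :: "(nat \<Rightarrow> nat) \<Rightarrow> nat \<Rightarrow> nat" where
  "up f n = (case n of 0 \<Rightarrow> 0 | Suc m \<Rightarrow> Suc (f m))"

lemma up_simps [simp]: "up f 0 = 0" "up f (Suc n) = Suc (f n)"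
  by (simp_all add: up_def)

lemma up_id [simp]: "up id = id" "up (\<lambda>x. x) = (\<lambda>x. x)"
  by (auto simp: up_def fun_eq_iff split: nat.split)

lemma up_comp: "up f \<circ> up g = up (f \<circ> g)"
  by (auto simp: up_def fun_eq_iff split: nat.split)

lemma inj_up: "inj f \<Longrightarrow> inj (up f)"
proof (rule injI)
  fix x y assume "inj f" "up f x = up f y"
  then show "x = y" by (cases x; cases y) (auto dest: injD)
qed

lemma up_eq_Suc: "up f n = Suc m \<longleftrightarrow> (\<exists>n'. n = Suc n' \<and> f n' = m)"
  by (cases n) auto

lemma up_eq_0 [simp]: "up f n = 0 \<longleftrightarrow> n = 0"
  by (cases n) auto

fun rn :: "(nat \<Rightarrow> nat) \<Rightarrow> dproc \<Rightarrow> dproc" where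
  "rn f DNil = DNil"
| "rn f (DOut x y) = DOut (f x) (f y)"
| "rn f (DIn x P) = DIn (f x) (rn (up f) P)"
| "rn f (DRes P) = DRes (rn (up f) P)"
| "rn f (DPar P Q) = DPar (rn f P) (rn f Q)"
| "rn f (DBang P) = DBang (rn f P)"

lemma rn_rn: "rn f (rn g P) = rn (f \<circ> g) P"
  by (induction P arbitrary: f g) (simp_all add: up_comp)

lemma rn_ident: "rn (\<lambda>x. x) P = P"
  by (induction P) simp_all

lemma rn_id [simp]: "rn id P = P"
  by (simp add: id_def rn_ident)

fun dfn :: "dproc \<Rightarrow> nat set" where
  "dfn DNil = {}"
| "dfn (DOut x y) = {x, y}"
| "dfn (DIn x P) = insert x (Suc -` dfn P)"
| "dfn (DRes P) = Suc -` dfn P"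
| "dfn (DPar P Q) = dfn P \<union> dfn Q"
| "dfn (DBang P) = dfn P"

lemma Suc_vimage_up: "Suc -` up f ` A = f ` (Suc -` A)"
proof -
  have "m \<in> Suc -` up f ` A \<longleftrightarrow> m \<in> f ` (Suc -` A)" for m
    unfolding vimage_eq image_iff by (metis up_eq_Suc vimage_eq)
  then show ?thesis by blast
qed

lemma dfn_rn [simp]: "dfn (rn f P) = f ` dfn P"
  by (induction P arbitrary: f) (auto simp: Suc_vimage_up)

text \<open>When a label that binds index 0 passes below a restriction, the pending name and the
  restricted one change places. The same transposition expresses the exchange of two
  restrictions.\<close>

definition sw :: "nat \<Rightarrow> nat" where
  "sw n = (if n = 0 then 1 else if n = 1 then 0 else n)"

lemma sw_simps [simp]: "sw 0 = Suc 0" "sw (Suc 0) = 0" "sw (Suc (Suc n)) = Suc (Suc n)"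
  by (simp_all add: sw_def)

lemma sw_sw [simp]: "sw \<circ> sw = id" "sw (sw n) = n"
  by (auto simp: sw_def fun_eq_iff)

text \<open>The rules \<open>e_swap\<close> and \<open>e_unfold\<close> have no counterpart in \<^const>\<open>scong\<close>. Without
  \<open>e_swap\<close> extrusion would not be a bisimulation, because \<open>Close\<close> places the restriction it
  creates outside or inside an extruded one. With \<open>e_unfold\<close> an output can be split off
  even if it stems from a replication.\<close>

inductive eqv :: "dproc \<Rightarrow> dproc \<Rightarrow> bool" where
  e_refl: "eqv P P"
| e_sym: "eqv P Q \<Longrightarrow> eqv Q P"
| e_trans: "eqv P Q \<Longrightarrow> eqv Q R \<Longrightarrow> eqv P R"
| e_nil: "eqv (DPar P DNil) P"
| e_comm: "eqv (DPar P Q) (DPar Q P)"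
| e_assoc: "eqv (DPar (DPar P Q) R) (DPar P (DPar Q R))"
| e_extr: "eqv (DPar (DRes P) Q) (DRes (DPar P (rn Suc Q)))"
| e_swap: "eqv (DRes (DRes (rn sw P))) (DRes (DRes P))"
| e_unfold: "eqv (DBang P) (DPar P (DBang P))"
| e_In: "eqv P Q \<Longrightarrow> eqv (DIn x P) (DIn x Q)"
| e_Res: "eqv P Q \<Longrightarrow> eqv (DRes P) (DRes Q)"
| e_Par: "eqv P P' \<Longrightarrow> eqv Q Q' \<Longrightarrow> eqv (DPar P Q) (DPar P' Q')"
| e_Bang: "eqv P Q \<Longrightarrow> eqv (DBang P) (DBang Q)"

lemma up_up_sw: "up (up f) \<circ> sw = sw \<circ> up (up f)"
  by (auto simp: fun_eq_iff up_def sw_def split: nat.split)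

lemma up_Suc_comm: "up f \<circ> Suc = Suc \<circ> f"
  by auto

lemma eqv_rn: "eqv P Q \<Longrightarrow> eqv (rn f P) (rn f Q)"
proof (induction arbitrary: f rule: eqv.induct)
  case (e_extr P Q)
  have "rn (up f) (rn Suc Q) = rn Suc (rn f Q)"
    by (simp only: rn_rn up_Suc_comm)
  then show ?case using eqv.e_extr[of "rn (up f) P" "rn f Q"] by simp
next
  case (e_swap P)
  have "rn (up (up f)) (rn sw P) = rn sw (rn (up (up f)) P)"
    by (simp only: rn_rn up_up_sw)
  then show ?case using eqv.e_swap[of "rn (up (up f)) P"] by simp
next
  case (e_sym P Q)
  then show ?case by (blast intro: eqv.e_sym)
next
  case (e_trans P Q R)
  then show ?case by (blast intro: eqv.e_trans)
qed (simp_all add: e_refl e_nil e_comm e_assoc e_unfold e_In e_Res e_Par e_Bang)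

lemma Suc_vimage_Suc_image [simp]: "Suc -` Suc ` A = A"
  by auto

lemma dfn_eqv: "eqv P Q \<Longrightarrow> dfn P = dfn Q"
proof (induction rule: eqv.induct)
  case (e_swap P)
  show ?case by (auto simp: image_iff) (metis sw_simps(3) sw_sw(2))+
qed auto

\<comment> \<open>In the quotient the laws for \<open>DNil\<close> and \<open>DPar\<close> are those
  of a commutative monoid, so that rearranging components is left to \<open>ac_simps\<close>, and
  congruent residuals become equal.\<close>
quotient_type pc = dproc / eqv
  by (rule equivpI) (auto simp: reflp_def symp_def transp_def intro: e_refl e_sym dest: e_trans)

instantiation pc :: comm_monoid_add
begin
lift_definition zero_pc :: pc is DNil .
lift_definition plus_pc :: "pc \<Rightarrow> pc \<Rightarrow> pc" is DPar by (rule e_Par)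
instance
proof
  fix a b c :: pc
  show "a + b + c = a + (b + c)" by transfer (rule e_assoc)
  show "a + b = b + a" by transfer (rule e_comm)
  show "0 + a = a" by transfer (rule e_trans[OF e_comm e_nil])
qed
end

lift_definition qres :: "pc \<Rightarrow> pc" is DRes by (rule e_Res)
lift_definition qrn :: "(nat \<Rightarrow> nat) \<Rightarrow> pc \<Rightarrow> pc" is rn by (rule eqv_rn)
lift_definition qfn :: "pc \<Rightarrow> nat set" is dfn by (rule dfn_eqv)

lemma abs_pc_simps [simp]:
  "abs_pc DNil = 0"
  "abs_pc (DPar P Q) = abs_pc P + abs_pc Q"
  "abs_pc (DRes P) = qres (abs_pc P)"
  "abs_pc (rn f P) = qrn f (abs_pc P)"
  by (simp_all add: zero_pc_def plus_pc.abs_eq qres.abs_eq qrn.abs_eq)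

lemma abs_pc_eq_iff: "abs_pc P = abs_pc Q \<longleftrightarrow> eqv P Q"
  by (rule pc.abs_eq_iff)

lemma qrn_simps [simp]:
  "qrn f 0 = 0"
  "qrn f (X + Y) = qrn f X + qrn f Y"
  "qrn f (qres X) = qres (qrn (up f) X)"
  "qrn id X = X"
  by (transfer, simp add: e_refl)+

lemma qrn_qrn: "qrn f (qrn g X) = qrn (f \<circ> g) X"
  by transfer (simp add: rn_rn e_refl)

lemma qres_add: "qres X + Y = qres (X + qrn Suc Y)"
  by transfer (rule e_extr)

lemma add_qres: "Y + qres X = qres (qrn Suc Y + X)"
  by (metis add.commute qres_add)

lemma qres_swap: "qres (qres (qrn sw X)) = qres (qres X)"
  by transfer (rule e_swap)

lemma bang_unfold: "abs_pc (DBang P) = abs_pc P + abs_pc (DBang P)"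
  using e_unfold[of P] by (simp flip: abs_pc_eq_iff)

section \<open>Late transitions, and congruence as a bisimulation\<close>

text \<open>In the residual of \<open>VBOut\<close> and \<open>VIn\<close> the index 0 stands for the extruded name and for the
  name still to be received.\<close>

datatype vlab = VOut nat nat | VBOut nat | VIn nat

fun vmap :: "(nat \<Rightarrow> nat) \<Rightarrow> vlab \<Rightarrow> vlab" where
  "vmap f (VOut u v) = VOut (f u) (f v)"
| "vmap f (VBOut u) = VBOut (f u)"
| "vmap f (VIn u) = VIn (f u)"

fun binding :: "vlab \<Rightarrow> bool" where
  "binding (VOut u v) = False"
| "binding (VBOut u) = True"
| "binding (VIn u) = True"

lemma binding_vmap [simp]: "binding (vmap f l) = binding l"
  by (cases l) auto

lemma vmap_vmap: "vmap f (vmap g l) = vmap (f \<circ> g) l"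
  by (cases l) auto

text \<open>In the residual of a binding label index 0 is a pending name. An idle neighbour is
  therefore shifted (\<open>vsh\<close>), an enclosing restriction is exchanged with that name
  (\<open>vsw\<close>), and a renaming is lifted over it (\<open>vrn\<close>).\<close>

definition vsh :: "vlab \<Rightarrow> pc \<Rightarrow> pc" where
  "vsh l X = (if binding l then qrn Suc X else X)"

definition vsw :: "vlab \<Rightarrow> pc \<Rightarrow> pc" where
  "vsw l X = (if binding l then qrn sw X else X)"

definition vrn :: "vlab \<Rightarrow> (nat \<Rightarrow> nat) \<Rightarrow> pc \<Rightarrow> pc" where
  "vrn l f X = qrn (if binding l then up f else f) X"

definition inst :: "nat \<Rightarrow> nat \<Rightarrow> nat" where
  "inst v n = (case n of 0 \<Rightarrow> v | Suc m \<Rightarrow> m)"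

lemma inst_simps [simp]: "inst v 0 = v" "inst v (Suc n) = n"
  by (simp_all add: inst_def)

text \<open>Computing the set of residuals by recursion on the term turns bisimilarity into an
  equation between functions. The second part of the \<open>DRes\<close> clause is Open: index 0
  changes from the restricted to the extruded name, so the residual is kept as it is. For
  \<open>DBang\<close> a single copy moves; idle copies are absorbed by
  \<open>bang_unfold\<close>.\<close>

primrec visc :: "dproc \<Rightarrow> vlab \<Rightarrow> pc set" where
  "visc DNil l = {}"
| "visc (DOut x y) l = (if l = VOut x y then {0} else {})"
| "visc (DIn x P) l = (if l = VIn x then {abs_pc P} else {})"
| "visc (DRes P) l = (\<lambda>X. qres (vsw l X)) ` visc P (vmap Suc l) \<union>
     (case l of VBOut u \<Rightarrow> visc P (VOut (Suc u) 0) | _ \<Rightarrow> {})"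
| "visc (DPar P Q) l = (\<lambda>X. X + vsh l (abs_pc Q)) ` visc P l \<union> (\<lambda>X. X + vsh l (abs_pc P)) ` visc Q l"
| "visc (DBang P) l = (\<lambda>X. X + vsh l (abs_pc (DBang P))) ` visc P l"

text \<open>The two parts are Com, where \<open>inst\<close> fills in the received name, and Close,
  where the pending names of both partners are identified and restricted. Only \<open>F\<close>
  sends, so a parallel composition needs both orders of the arguments.\<close>

definition comm :: "(vlab \<Rightarrow> pc set) \<Rightarrow> (vlab \<Rightarrow> pc set) \<Rightarrow> pc set" where
  "comm F G = {X + qrn (inst v) Y | u v X Y. X \<in> F (VOut u v) \<and> Y \<in> G (VIn u)} \<union>
     {qres (X + Y) | u X Y. X \<in> F (VBOut u) \<and> Y \<in> G (VIn u)}"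

primrec tauc :: "dproc \<Rightarrow> pc set" where
  "tauc DNil = {}"
| "tauc (DOut x y) = {}"
| "tauc (DIn x P) = {}"
| "tauc (DRes P) = qres ` tauc P"
| "tauc (DPar P Q) = (\<lambda>X. X + abs_pc Q) ` tauc P \<union> (\<lambda>X. X + abs_pc P) ` tauc Q \<union>
     comm (visc P) (visc Q) \<union> comm (visc Q) (visc P)"
| "tauc (DBang P) = (\<lambda>X. X + abs_pc (DBang P)) ` (tauc P \<union> comm (visc P) (visc P))"

section \<open>Transitions and renaming\<close>

lemma vsh_simps [simp]: "vsh l (X + Y) = vsh l X + vsh l Y" "vsh l 0 = 0"
  by (simp_all add: vsh_def)

lemma qrn_up_Suc: "qrn (up f) (qrn Suc X) = qrn Suc (qrn f X)"
  by (simp only: qrn_qrn up_Suc_comm)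

lemma vrn_simps [simp]: "vrn l f (X + Y) = vrn l f X + vrn l f Y" "vrn l f (vsh l X) = vsh l (qrn f X)"
  by (simp_all add: vrn_def vsh_def qrn_up_Suc)

lemma vsh_vmap [simp]: "vsh (vmap f l) = vsh l" and vsw_vmap [simp]: "vsw (vmap f l) = vsw l"
  and vrn_vmap [simp]: "vrn (vmap f l) = vrn l"
  by (simp_all add: fun_eq_iff vsh_def vsw_def vrn_def)

lemma vrn_qres [simp]: "vrn l f (qres (vsw l X)) = qres (vsw l (vrn l (up f) X))"
  by (simp add: vrn_def vsw_def qrn_qrn up_up_sw)

lemma qrn_Bang: "qrn f (abs_pc (DBang P)) = abs_pc (DBang (rn f P))"
  by (simp flip: abs_pc_simps(4))

lemma visc_rn: "X \<in> visc P l \<Longrightarrow> vrn l f X \<in> visc (rn f P) (vmap f l)"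
proof (induction P arbitrary: f l X)
  case (DRes P)
  from DRes.prems consider (a) Y where "Y \<in> visc P (vmap Suc l)" "X = qres (vsw l Y)"
    | (b) u where "l = VBOut u" "X \<in> visc P (VOut (Suc u) 0)"
    by (auto split: vlab.splits)
  then show ?case
  proof cases
    case a
    from DRes.IH[OF a(1), of "up f"]
    have "vrn l (up f) Y \<in> visc (rn (up f) P) (vmap Suc (vmap f l))"
      by (simp add: vmap_vmap up_Suc_comm)
    then show ?thesis by (auto simp: a(2))
  next
    case b
    from DRes.IH[OF b(2), of "up f"] show ?thesis by (simp add: b vrn_def)
  qed
next
  case (DPar P Q)
  then show ?case by auto
next
  case (DBang P)
  then show ?case by (auto simp: qrn_Bang)
qed (auto simp: vrn_def split: if_splits)

text \<open>Only 0 is sent to 0 by \<open>up f\<close>, so a label that avoids the bound index after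
  a lifted renaming avoided it before.\<close>

lemma vmap_Suc_eq_up: "vmap Suc l' = vmap (up f) l \<Longrightarrow> \<exists>l0. l = vmap Suc l0 \<and> l' = vmap f l0"
proof (cases l)
  case (VOut u v)
  assume "vmap Suc l' = vmap (up f) l"
  with VOut obtain u' v' where "u = Suc u'" "v = Suc v'" "l' = vmap f (VOut u' v')"
    by (cases l') (auto simp: up_eq_Suc eq_commute[of "Suc _"])
  with VOut show ?thesis by (intro exI[of _ "VOut u' v'"]) auto
next
  case (VBOut u)
  assume "vmap Suc l' = vmap (up f) l"
  with VBOut obtain u' where "u = Suc u'" "l' = vmap f (VBOut u')"
    by (cases l') (auto simp: up_eq_Suc eq_commute[of "Suc _"])
  with VBOut show ?thesis by (intro exI[of _ "VBOut u'"]) auto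
next
  case (VIn u)
  assume "vmap Suc l' = vmap (up f) l"
  with VIn obtain u' where "u = Suc u'" "l' = vmap f (VIn u')"
    by (cases l') (auto simp: up_eq_Suc eq_commute[of "Suc _"])
  with VIn show ?thesis by (intro exI[of _ "VIn u'"]) auto
qed

lemma visc_rnD: "Y \<in> visc (rn f P) l' \<Longrightarrow> \<exists>l X. l' = vmap f l \<and> X \<in> visc P l \<and> Y = vrn l f X"
proof (induction P arbitrary: f l' Y)
  case (DRes P)
  from DRes.prems consider (a) Z where "Z \<in> visc (rn (up f) P) (vmap Suc l')" "Y = qres (vsw l' Z)"
    | (b) u where "l' = VBOut u" "Y \<in> visc (rn (up f) P) (VOut (Suc u) 0)"
    by (auto split: vlab.splits)
  then show ?case
  proof cases
    case a
    from DRes.IH[OF a(1)] obtain l X where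
      1: "vmap Suc l' = vmap (up f) l" "X \<in> visc P l" "Z = vrn l (up f) X" by blast
    from vmap_Suc_eq_up[OF 1(1)] obtain l0 where l0: "l = vmap Suc l0" "l' = vmap f l0" by blast
    have "Y = vrn l0 f (qres (vsw l0 X))"
      by (simp add: a(2) l0 1(3))
    moreover have "qres (vsw l0 X) \<in> visc (DRes P) l0" using 1 l0 by auto
    ultimately show ?thesis using l0 by blast
  next
    case b
    from DRes.IH[OF b(2)] obtain l X where
      1: "VOut (Suc u) 0 = vmap (up f) l" "X \<in> visc P l" "Y = vrn l (up f) X" by blast
    from 1(1) obtain u' where "l = VOut (Suc u') 0" "u = f u'"
      by (cases l) (auto simp: up_eq_Suc eq_commute[of "Suc _"])
    with 1 b show ?thesis by (intro exI[of _ "VBOut u'"] exI[of _ X]) (auto simp: vrn_def)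
  qed
next
  case (DPar P Q)
  from DPar.prems consider (a) Z where "Z \<in> visc (rn f P) l'" "Y = Z + vsh l' (abs_pc (rn f Q))"
    | (b) Z where "Z \<in> visc (rn f Q) l'" "Y = Z + vsh l' (abs_pc (rn f P))" by auto
  then show ?case
  proof cases
    case a
    from DPar.IH(1)[OF a(1)] obtain l X where
      "l' = vmap f l" "X \<in> visc P l" "Z = vrn l f X" by blast
    then show ?thesis using a
      by (intro exI[of _ l] exI[of _ "X + vsh l (abs_pc Q)"]) auto
  next
    case b
    from DPar.IH(2)[OF b(1)] obtain l X where
      "l' = vmap f l" "X \<in> visc Q l" "Z = vrn l f X" by blast
    then show ?thesis using b
      by (intro exI[of _ l] exI[of _ "X + vsh l (abs_pc P)"]) auto
  qed
next
  case (DBang P)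
  from DBang.prems obtain Z where a: "Z \<in> visc (rn f P) l'" "Y = Z + vsh l' (abs_pc (DBang (rn f P)))" by auto
  from DBang.IH[OF a(1)] obtain l X where
      "l' = vmap f l" "X \<in> visc P l" "Z = vrn l f X" by blast
  then show ?case using a
      by (intro exI[of _ l] exI[of _ "X + vsh l (abs_pc (DBang P))"]) (auto simp: qrn_Bang)
next
  case (DOut x y)
  then show ?case by (intro exI[of _ "VOut x y"]) (auto simp: vrn_def split: if_splits)
next
  case (DIn x y)
  then show ?case by (intro exI[of _ "VIn x"]) (auto simp: vrn_def split: if_splits)
qed auto

lemma inst_comp: "inst v \<circ> Suc = id" "f \<circ> inst v = inst (f v) \<circ> up f" "inst 0 \<circ> up Suc = id"
  by (auto simp: fun_eq_iff inst_def up_def split: nat.split)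

lemma comm_rn:
  assumes "X \<in> comm (visc P) (visc Q)"
  shows "qrn f X \<in> comm (visc (rn f P)) (visc (rn f Q))"
proof -
  from assms consider (a) u v Y Z where "Y \<in> visc P (VOut u v)" "Z \<in> visc Q (VIn u)" "X = Y + qrn (inst v) Z"
    | (b) u Y Z where "Y \<in> visc P (VBOut u)" "Z \<in> visc Q (VIn u)" "X = qres (Y + Z)"
    by (auto simp: comm_def)
  then show ?thesis
  proof cases
    case a
    have "qrn f X = qrn f Y + qrn (inst (f v)) (qrn (up f) Z)" by (simp add: a qrn_qrn inst_comp)
    with visc_rn[OF a(1), of f] visc_rn[OF a(2), of f] show ?thesis
      by (auto simp: comm_def vrn_def)
  next
    case b
    have "qrn f X = qres (qrn (up f) Y + qrn (up f) Z)" by (simp add: b)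
    with visc_rn[OF b(1), of f] visc_rn[OF b(2), of f] show ?thesis
      by (auto simp: comm_def vrn_def)
  qed
qed

text \<open>Injectivity of \<open>f\<close> keeps distinct channels distinct; a renaming that merges
  an output channel with an input channel would create a communication.\<close>

lemma comm_rnD:
  assumes "inj f" "Y \<in> comm (visc (rn f P)) (visc (rn f Q))"
  shows "\<exists>X\<in>comm (visc P) (visc Q). Y = qrn f X"
proof -
  from assms(2) consider (a) u v Y' Z where "Y' \<in> visc (rn f P) (VOut u v)" "Z \<in> visc (rn f Q) (VIn u)" "Y = Y' + qrn (inst v) Z"
    | (b) u Y' Z where "Y' \<in> visc (rn f P) (VBOut u)" "Z \<in> visc (rn f Q) (VIn u)" "Y = qres (Y' + Z)"
    by (auto simp: comm_def)
  then show ?thesis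
  proof cases
    case a
    from visc_rnD[OF a(1)] obtain l1 X1 where 1: "VOut u v = vmap f l1" "X1 \<in> visc P l1" "Y' = vrn l1 f X1" by blast
    from visc_rnD[OF a(2)] obtain l2 X2 where 2: "VIn u = vmap f l2" "X2 \<in> visc Q l2" "Z = vrn l2 f X2" by blast
    from 1(1) obtain u1 v1 where l1: "l1 = VOut u1 v1" "u = f u1" "v = f v1" by (cases l1) auto
    from 2(1) l1 \<open>inj f\<close> have l2: "l2 = VIn u1" by (cases l2) (auto dest: injD)
    have "X1 + qrn (inst v1) X2 \<in> comm (visc P) (visc Q)" using 1 2 l1 l2 by (auto simp: comm_def)
    moreover have "Y = qrn f (X1 + qrn (inst v1) X2)" by (simp add: a 1 2 l1 l2 vrn_def qrn_qrn inst_comp)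
    ultimately show ?thesis by blast
  next
    case b
    from visc_rnD[OF b(1)] obtain l1 X1 where 1: "VBOut u = vmap f l1" "X1 \<in> visc P l1" "Y' = vrn l1 f X1" by blast
    from visc_rnD[OF b(2)] obtain l2 X2 where 2: "VIn u = vmap f l2" "X2 \<in> visc Q l2" "Z = vrn l2 f X2" by blast
    from 1(1) obtain u1 where l1: "l1 = VBOut u1" "u = f u1" by (cases l1) auto
    from 2(1) l1 \<open>inj f\<close> have l2: "l2 = VIn u1" by (cases l2) (auto dest: injD)
    have "qres (X1 + X2) \<in> comm (visc P) (visc Q)" using 1 2 l1 l2 by (auto simp: comm_def)
    moreover have "Y = qrn f (qres (X1 + X2))" by (simp add: b 1 2 l1 l2 vrn_def)
    ultimately show ?thesis by blast
  qed
qed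

lemma tauc_rn: "X \<in> tauc P \<Longrightarrow> qrn f X \<in> tauc (rn f P)"
proof (induction P arbitrary: f X)
  case (DRes P)
  then show ?case by auto
next
  case (DPar P Q)
  then show ?case by (auto dest: comm_rn[where f=f])
next
  case (DBang P)
  then show ?case by (auto simp: qrn_Bang dest: comm_rn[where f=f])
qed auto

lemma tauc_rnD: "inj f \<Longrightarrow> Y \<in> tauc (rn f P) \<Longrightarrow> \<exists>X\<in>tauc P. Y = qrn f X"
proof (induction P arbitrary: f Y)
  case (DRes P)
  from DRes.prems(2) obtain Z where "Z \<in> tauc (rn (up f) P)" "Y = qres Z" by auto
  with DRes.IH[OF inj_up[OF DRes.prems(1)], of Z] show ?case by force
next
  case (DPar P Q)
  from DPar.prems(2) consider (a) Z where "Z \<in> tauc (rn f P)" "Y = Z + qrn f (abs_pc Q)"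
    | (b) Z where "Z \<in> tauc (rn f Q)" "Y = Z + qrn f (abs_pc P)"
    | (c) "Y \<in> comm (visc (rn f P)) (visc (rn f Q))"
    | (d) "Y \<in> comm (visc (rn f Q)) (visc (rn f P))" by auto
  then show ?case
  proof cases
    case a with DPar.IH(1)[OF DPar.prems(1), of Z] show ?thesis by force
  next
    case b with DPar.IH(2)[OF DPar.prems(1), of Z] show ?thesis by force
  next
    case c with comm_rnD[OF DPar.prems(1)] show ?thesis by fastforce
  next
    case d with comm_rnD[OF DPar.prems(1)] show ?thesis by fastforce
  qed
next
  case (DBang P)
  from DBang.prems(2) obtain Z where Z: "Y = Z + qrn f (abs_pc (DBang P))"
    "Z \<in> tauc (rn f P) \<or> Z \<in> comm (visc (rn f P)) (visc (rn f P))" by (auto simp: qrn_Bang)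
  with DBang.IH[OF DBang.prems(1), of Z] comm_rnD[OF DBang.prems(1), of Z P P]
  obtain X where "X \<in> tauc P \<union> comm (visc P) (visc P)" "Z = qrn f X" by auto
  with Z show ?case by force
qed auto

section \<open>Communication in the presence of idle components\<close>

lemma comm_Un: "comm (\<lambda>l. F l \<union> G l) H = comm F H \<union> comm G H"
  "comm H (\<lambda>l. F l \<union> G l) = comm H F \<union> comm H G"
  unfolding comm_def by blast+

lemma qrn_inst_Suc: "qrn (inst v) (qrn Suc X) = X"
  by (simp add: qrn_qrn inst_comp)

text \<open>An idle component \<open>R\<close> stays outside the communication: for Com by
  rearranging the sum, for Close by scope extrusion, since \<open>R\<close> is shifted past the new
  restriction. With these laws the invariance of \<open>tauc\<close> under associativity and
  unfolding is a matter of rewriting.\<close>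

lemma comm_shift1: "comm (\<lambda>l. (\<lambda>X. X + vsh l R) ` F l) G = (\<lambda>X. X + R) ` comm F G"
proof -
  have 1: "X + R + qrn (inst v) Y = X + qrn (inst v) Y + R" for X v Y by (simp add: ac_simps)
  have 2: "qres (X + qrn Suc R + Y) = qres (X + Y) + R" for X Y by (metis qres_add add.assoc add.commute)
  have "comm (\<lambda>l. (\<lambda>X. X + vsh l R) ` F l) G =
     {X + R + qrn (inst v) Y | u v X Y. X \<in> F (VOut u v) \<and> Y \<in> G (VIn u)} \<union>
     {qres (X + qrn Suc R + Y) | u X Y. X \<in> F (VBOut u) \<and> Y \<in> G (VIn u)}"
    unfolding comm_def by (simp add: vsh_def del: qrn_simps) blast
  also have "\<dots> = (\<lambda>X. X + R) ` comm F G"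
    unfolding 1 2 unfolding comm_def by blast
  finally show ?thesis .
qed

lemma comm_shift2: "comm F (\<lambda>l. (\<lambda>X. X + vsh l R) ` G l) = (\<lambda>X. X + R) ` comm F G"
proof -
  have 1: "X + qrn (inst v) (Y + qrn Suc R) = X + qrn (inst v) Y + R" for X v Y by (simp add: ac_simps qrn_inst_Suc)
  have 2: "qres (X + (Y + qrn Suc R)) = qres (X + Y) + R" for X Y by (simp only: qres_add add.assoc)
  have "comm F (\<lambda>l. (\<lambda>X. X + vsh l R) ` G l) =
     {X + qrn (inst v) (Y + qrn Suc R) | u v X Y. X \<in> F (VOut u v) \<and> Y \<in> G (VIn u)} \<union>
     {qres (X + (Y + qrn Suc R)) | u X Y. X \<in> F (VBOut u) \<and> Y \<in> G (VIn u)}"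
    unfolding comm_def by (simp add: vsh_def del: qrn_simps) blast
  also have "\<dots> = (\<lambda>X. X + R) ` comm F G"
    unfolding 1 2 unfolding comm_def by blast
  finally show ?thesis .
qed

lemma visc_Par: "visc (DPar P Q) = (\<lambda>l. (\<lambda>X. X + vsh l (abs_pc Q)) ` visc P l \<union> (\<lambda>X. X + vsh l (abs_pc P)) ` visc Q l)"
  by (rule ext) simp

lemma visc_Bang: "visc (DBang P) = (\<lambda>l. (\<lambda>X. X + vsh l (abs_pc (DBang P))) ` visc P l)"
  by (rule ext) simp

lemmas comm_distribs = visc_Par visc_Bang comm_Un comm_shift1 comm_shift2

text \<open>The braid relation for the transpositions of 0, 1 and of 1, 2. It is needed when a
  binding label passes below two restrictions that are to be exchanged.\<close>

lemma up_sw_braid: "sw \<circ> (up sw \<circ> sw) = up sw \<circ> (sw \<circ> up sw)"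
proof
  fix n show "(sw \<circ> (up sw \<circ> sw)) n = (up sw \<circ> (sw \<circ> up sw)) n"
    by (cases n; cases "n - 1"; cases "n - 2") (auto simp: sw_def up_def split: nat.splits)
qed

lemma visc_swap_sub: "visc (DRes (DRes (rn sw P))) l \<subseteq> visc (DRes (DRes P)) l"
proof -
  have "visc (DRes (DRes P)) l \<subseteq> visc (DRes (DRes (rn sw P))) l" for P
  proof
    fix X assume "X \<in> visc (DRes (DRes P)) l"
    \<comment> \<open>Neither restriction is opened (a), the inner one is extruded (b), or the outer
      one is (c). The exchange turns b and c into each other.\<close>
    then consider
      (a) Y where "Y \<in> visc P (vmap Suc (vmap Suc l))" "X = qres (vsw l (qres (vsw l Y)))"
    | (b) Y u where "Y \<in> visc P (VOut (Suc (Suc u)) 0)" "l = VBOut u" "X = qres (vsw l Y)"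
    | (c) Y u where "Y \<in> visc P (VOut (Suc (Suc u)) (Suc 0))" "l = VBOut u" "X = qres Y"
      by (cases l) (auto simp: vsw_def)
    then show "X \<in> visc (DRes (DRes (rn sw P))) l"
    proof cases
      case a
      have 1: "vrn l sw Y \<in> visc (rn sw P) (vmap Suc (vmap Suc l))"
        using visc_rn[OF a(1), of sw] by (simp add: vmap_vmap comp_def)
      have "qres (vsw l (qres (vsw l Y))) = qres (vsw l (qres (vsw l (vrn l sw Y))))"
      proof (cases "binding l")
        case True
        have "qres (qres (qrn (up sw \<circ> (sw \<circ> up sw)) Y)) = qres (qres (qrn (up sw \<circ> sw) Y))"
          unfolding up_sw_braid[symmetric] by (metis qres_swap qrn_qrn)
        with True show ?thesis by (simp add: vsw_def vrn_def qrn_qrn comp_assoc)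
      next
        case False
        then show ?thesis by (simp add: vsw_def vrn_def qres_swap)
      qed
      then show ?thesis using 1 a by auto
    next
      case b
      from visc_rn[OF b(1), of sw] show ?thesis by (force simp: b vsw_def vrn_def)
    next
      case c
      from visc_rn[OF c(1), of sw] have "qrn sw Y \<in> visc (rn sw P) (VOut (Suc (Suc u)) 0)" by (simp add: vrn_def)
      moreover have "X = qres (qrn sw (qrn sw Y))" by (simp add: c qrn_qrn)
      ultimately show ?thesis unfolding c by (force simp: vsw_def)
    qed
  qed
  \<comment> \<open>As \<open>sw\<close> is an involution, the inclusion just shown, taken for
    \<open>rn sw P\<close>, is the converse one for \<open>P\<close>.\<close>
  from this[of "rn sw P"] show ?thesis by (simp add: rn_rn)
qed

lemma visc_swap: "visc (DRes (DRes (rn sw P))) l = visc (DRes (DRes P)) l"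
  using visc_swap_sub[of P l] visc_swap_sub[of "rn sw P" l] by (simp add: rn_rn subset_antisym)

section \<open>Scope extrusion\<close>

lemma visc_rn_Suc: "visc (rn Suc P) (vmap Suc l) = vrn l Suc ` visc P l"
proof
  show "vrn l Suc ` visc P l \<subseteq> visc (rn Suc P) (vmap Suc l)" by (auto intro: visc_rn)
  show "visc (rn Suc P) (vmap Suc l) \<subseteq> vrn l Suc ` visc P l"
  proof
    fix Y assume "Y \<in> visc (rn Suc P) (vmap Suc l)"
    from visc_rnD[OF this] obtain l' X where 1: "vmap Suc l = vmap Suc l'" "X \<in> visc P l'" "Y = vrn l' Suc X" by blast
    from 1(1) have "l = l'" by (cases l; cases l') auto
    with 1 show "Y \<in> vrn l Suc ` visc P l" by auto
  qed
qed

text \<open>A shifted term does not contain index 0 and cannot send the name restricted around it.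
  In an extrusion only the process originally in scope can therefore perform Open.\<close>

lemma visc_rn_Suc_0: "visc (rn Suc P) (VOut u 0) = {}"
proof (rule equals0I)
  fix Y assume "Y \<in> visc (rn Suc P) (VOut u 0)"
  from visc_rnD[OF this] obtain l where "VOut u 0 = vmap Suc l" by blast
  then show False by (cases l) auto
qed

lemma sw_up_Suc: "sw \<circ> up Suc = Suc"
  by (auto simp: fun_eq_iff up_def split: nat.split)

lemma sw_Suc: "sw \<circ> Suc = up Suc"
  by (auto simp: fun_eq_iff up_def sw_def split: nat.split)

lemma visc_extr: "visc (DPar (DRes P) Q) l = visc (DRes (DPar P (rn Suc Q))) l"
proof -
  have 1: "qres (vsw l X) + vsh l Y = qres (vsw l (X + vsh l (qrn Suc Y)))" for X Y
    by (simp add: vsw_def vsh_def qres_add qrn_qrn) (simp add: sw_def fun_eq_iff comp_def)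
  have 2: "X + vsh l (qres Y) = qres (vsw l (vrn l Suc X + vsh l Y))" for X Y
    by (simp add: vsw_def vsh_def vrn_def add_qres qrn_qrn sw_up_Suc sw_Suc)
  have "visc (DRes (DPar P (rn Suc Q))) l =
     (\<lambda>X. qres (vsw l (X + vsh l (qrn Suc (abs_pc Q))))) ` visc P (vmap Suc l)
     \<union> (\<lambda>X. qres (vsw l (vrn l Suc X + vsh l (abs_pc P)))) ` visc Q l
     \<union> (case l of VBOut u \<Rightarrow> (\<lambda>X. X + vsh l (abs_pc Q)) ` visc P (VOut (Suc u) 0) | _ \<Rightarrow> {})"
    unfolding visc.simps image_Un image_image visc_rn_Suc vsh_vmap abs_pc_simps
    by (cases l) (simp_all add: visc_rn_Suc_0 vsh_def)
  also have "\<dots> = visc (DPar (DRes P) Q) l"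
    unfolding visc.simps image_Un image_image abs_pc_simps 1 2
    by (cases l) (simp_all add: Un_ac)
  finally show ?thesis by simp
qed

lemma tauc_rn_Suc: "tauc (rn Suc P) = qrn Suc ` tauc P"
  using tauc_rn[of _ P Suc] tauc_rnD[of Suc _ P] by force

lemma visc_rn_Suc_VIn: "Y \<in> visc (rn Suc Q) (VIn w) \<longleftrightarrow> (\<exists>u Z. w = Suc u \<and> Z \<in> visc Q (VIn u) \<and> Y = qrn (up Suc) Z)"
proof (cases w)
  case 0
  have False if "Y \<in> visc (rn Suc Q) (VIn w)"
  proof -
    from visc_rnD[OF that] obtain l where "VIn w = vmap Suc l" by blast
    with 0 show False by (cases l) auto
  qed
  with 0 show ?thesis by auto
next
  case (Suc u)
  then show ?thesis using visc_rn_Suc[of Q "VIn u"] by (auto simp: vrn_def)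
qed

lemma visc_rn_Suc_VBOut: "Y \<in> visc (rn Suc Q) (VBOut w) \<longleftrightarrow> (\<exists>u Z. w = Suc u \<and> Z \<in> visc Q (VBOut u) \<and> Y = qrn (up Suc) Z)"
proof (cases w)
  case 0
  have False if "Y \<in> visc (rn Suc Q) (VBOut w)"
  proof -
    from visc_rnD[OF that] obtain l where "VBOut w = vmap Suc l" by blast
    with 0 show False by (cases l) auto
  qed
  with 0 show ?thesis by auto
next
  case (Suc u)
  then show ?thesis using visc_rn_Suc[of Q "VBOut u"] by (auto simp: vrn_def)
qed

lemma visc_rn_Suc_VOut: "Y \<in> visc (rn Suc Q) (VOut w z) \<longleftrightarrow>
  (\<exists>u v Z. w = Suc u \<and> z = Suc v \<and> Z \<in> visc Q (VOut u v) \<and> Y = qrn Suc Z)"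
proof (cases "w = 0 \<or> z = 0")
  case True
  have False if "Y \<in> visc (rn Suc Q) (VOut w z)"
  proof -
    from visc_rnD[OF that] obtain l where "VOut w z = vmap Suc l" by blast
    with True show False by (cases l) auto
  qed
  with True show ?thesis by auto
next
  case False
  then obtain u v where "w = Suc u" "z = Suc v" by (meson not0_implies_Suc)
  then show ?thesis using visc_rn_Suc[of Q "VOut u v"] by (auto simp: vrn_def)
qed

lemma up_inst_sw: "up (inst v) \<circ> sw = inst (Suc v)"
  by (auto simp: fun_eq_iff up_def inst_def sw_def split: nat.split)

lemma qres_swap_add: "qres (qres (qrn sw X + qrn Suc Y)) = qres (qres (X + qrn (up Suc) Y))"
  "qres (qres (qrn Suc Y + qrn sw X)) = qres (qres (qrn (up Suc) Y + X))"
proof -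
  have "qrn sw (X + qrn (up Suc) Y) = qrn sw X + qrn Suc Y" by (simp add: qrn_qrn sw_up_Suc)
  then show 1: "qres (qres (qrn sw X + qrn Suc Y)) = qres (qres (X + qrn (up Suc) Y))"
    by (metis qres_swap)
  then show "qres (qres (qrn Suc Y + qrn sw X)) = qres (qres (qrn (up Suc) Y + X))"
    by (metis add.commute)
qed

lemma comm_extr_out: "comm (visc (DRes P)) (visc Q) = qres ` comm (visc P) (visc (rn Suc Q))"
proof -
  have 1: "qres X + qrn (inst v) Y = qres (X + qrn (inst (Suc v)) (qrn (up Suc) Y))" for X Y v
    by (simp add: qres_add qrn_qrn inst_comp)
  \<comment> \<open>In a Close that extrudes another name, the new restriction lies outside the old
    one on the left and inside it on the right.\<close>
  have 2: "qres (qres (qrn sw X) + Y) = qres (qres (X + qrn (up Suc) Y))" for X Y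
    by (simp add: qres_add qres_swap_add)
  \<comment> \<open>If the name sent is the restricted one itself, the Close on the left corresponds
    to a Com below the restriction on the right, which instantiates the input with index 0.\<close>
  have 3: "X + Y = X + qrn (inst 0) (qrn (up Suc) Y)" for X Y :: pc
    by (simp add: qrn_qrn inst_comp)
  have "comm (visc (DRes P)) (visc Q) =
    {qres X + qrn (inst v) Y | u v X Y. X \<in> visc P (VOut (Suc u) (Suc v)) \<and> Y \<in> visc Q (VIn u)} \<union>
    {qres (qres (qrn sw X) + Y) | u X Y. X \<in> visc P (VBOut (Suc u)) \<and> Y \<in> visc Q (VIn u)} \<union>
    {qres (X + Y) | u X Y. X \<in> visc P (VOut (Suc u) 0) \<and> Y \<in> visc Q (VIn u)}"
    unfolding comm_def by (simp add: vsw_def del: qrn_simps) blast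
  also have "\<dots> = qres ` comm (visc P) (visc (rn Suc Q))" (is "?L = ?R")
  proof
    show "?L \<subseteq> ?R"
      unfolding 1 2 unfolding comm_def visc_rn_Suc_VIn using 3 by blast
    show "?R \<subseteq> ?L"
    proof
      fix Z assume "Z \<in> ?R"
      then consider (a) u v X Y where "X \<in> visc P (VOut (Suc u) v)" "Y \<in> visc Q (VIn u)" "Z = qres (X + qrn (inst v) (qrn (up Suc) Y))"
        | (b) u X Y where "X \<in> visc P (VBOut (Suc u))" "Y \<in> visc Q (VIn u)" "Z = qres (qres (X + qrn (up Suc) Y))"
        unfolding comm_def visc_rn_Suc_VIn by blast
      then show "Z \<in> ?L"
      proof cases
        case a
        show ?thesis
        proof (cases v)
          case 0
          with a(3) have "Z = qres (X + Y)" using 3 by metis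
          with a 0 show ?thesis by blast
        next
          case (Suc v')
          with a(3) have "Z = qres X + qrn (inst v') Y" using 1 by metis
          with a Suc show ?thesis by blast
        qed
      next
        case b
        then have "Z = qres (qres (qrn sw X) + Y)" using 2 by metis
        with b show ?thesis by blast
      qed
    qed
  qed
  finally show ?thesis .
qed

text \<open>Here the restricted process receives. The sender does not know the restricted name, so
  all its labels are shifted ones and the received name never is index 0.\<close>

lemma comm_extr_in: "comm (visc Q) (visc (DRes P)) = qres ` comm (visc (rn Suc Q)) (visc P)"
proof -
  have 1: "Y + qrn (inst v) (qres (qrn sw X)) = qres (qrn Suc Y + qrn (inst (Suc v)) X)" for X Y v
    by (simp add: add_qres qrn_qrn up_inst_sw)
  have 2: "qres (Y + qres (qrn sw X)) = qres (qres (qrn (up Suc) Y + X))" for X Y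
    by (simp add: add_qres qres_swap_add)
  have "comm (visc Q) (visc (DRes P)) =
    {Y + qrn (inst v) (qres (qrn sw X)) | u v X Y. X \<in> visc P (VIn (Suc u)) \<and> Y \<in> visc Q (VOut u v)} \<union>
    {qres (Y + qres (qrn sw X)) | u X Y. X \<in> visc P (VIn (Suc u)) \<and> Y \<in> visc Q (VBOut u)}"
    unfolding comm_def by (simp add: vsw_def del: qrn_simps) blast
  also have "\<dots> = qres ` comm (visc (rn Suc Q)) (visc P)" (is "?L = ?R")
  proof
    show "?L \<subseteq> ?R"
      unfolding 1 2
    proof (rule Un_least; rule subsetI)
      fix Z assume "Z \<in> {qres (qrn Suc Y + qrn (inst (Suc v)) X) | u v X Y. X \<in> visc P (VIn (Suc u)) \<and> Y \<in> visc Q (VOut u v)}"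
      then obtain u v X Y where a: "Z = qres (qrn Suc Y + qrn (inst (Suc v)) X)" "X \<in> visc P (VIn (Suc u))" "Y \<in> visc Q (VOut u v)" by blast
      then have "qrn Suc Y \<in> visc (rn Suc Q) (VOut (Suc u) (Suc v))" using visc_rn_Suc_VOut by blast
      with a show "Z \<in> ?R" unfolding comm_def by blast
    next
      fix Z assume "Z \<in> {qres (qres (qrn (up Suc) Y + X)) | u X Y. X \<in> visc P (VIn (Suc u)) \<and> Y \<in> visc Q (VBOut u)}"
      then obtain u X Y where a: "Z = qres (qres (qrn (up Suc) Y + X))" "X \<in> visc P (VIn (Suc u))" "Y \<in> visc Q (VBOut u)" by blast
      then have "qrn (up Suc) Y \<in> visc (rn Suc Q) (VBOut (Suc u))" using visc_rn_Suc_VBOut by blast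
      with a show "Z \<in> ?R" unfolding comm_def by blast
    qed
    show "?R \<subseteq> ?L"
    proof
      fix Z assume "Z \<in> ?R"
      then consider (a) u v X Y where "X \<in> visc P (VIn (Suc u))" "Y \<in> visc Q (VOut u v)" "Z = qres (qrn Suc Y + qrn (inst (Suc v)) X)"
        | (b) u X Y where "X \<in> visc P (VIn (Suc u))" "Y \<in> visc Q (VBOut u)" "Z = qres (qres (qrn (up Suc) Y + X))"
        unfolding comm_def visc_rn_Suc_VOut visc_rn_Suc_VBOut by blast
      then show "Z \<in> ?L" unfolding 1[symmetric] 2[symmetric] by cases blast+
    qed
  qed
  finally show ?thesis .
qed

lemma tauc_extr: "tauc (DPar (DRes P) Q) = tauc (DRes (DPar P (rn Suc Q)))"
  unfolding tauc.simps image_Un image_image tauc_rn_Suc abs_pc_simps comm_extr_in comm_extr_out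
  by (simp add: qres_add add_qres add.commute)

text \<open>Since residuals are classes, equality of these functions says that \<open>eqv\<close> is
  a strong bisimulation for visible actions. Internal actions come afterwards because
  \<open>tauc\<close> refers to \<open>visc\<close> through \<open>comm\<close>.\<close>

lemma visc_eqv: "eqv P Q \<Longrightarrow> visc P = visc Q"
proof (induction rule: eqv.induct)
  case (e_extr P Q) show ?case by (rule ext) (rule visc_extr)
next
  case (e_swap P) show ?case by (rule ext) (rule visc_swap)
next
  case (e_nil P) show ?case by (rule ext) simp
next
  case (e_comm P Q) show ?case by (rule ext) auto
next
  case (e_assoc P Q R) show ?case by (rule ext) (simp add: image_Un image_image ac_simps)
next
  case (e_unfold P)
  \<comment> \<open>The unfolded copy, when idle, is absorbed by the replication.\<close>
  have "X + vsh l (abs_pc (DBang P)) + vsh l (abs_pc P) = X + vsh l (abs_pc (DBang P))" for X l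
    using bang_unfold[of P] by (metis add.assoc add.commute vsh_simps(1))
  then show ?case by (intro ext) (simp add: image_image)
next
  case (e_In P Q x) then show ?case by (intro ext) (simp add: abs_pc_eq_iff)
next
  case (e_Par P P' Q Q')
  then have "abs_pc P = abs_pc P'" "abs_pc Q = abs_pc Q'" by (simp_all add: abs_pc_eq_iff)
  with e_Par show ?case by (intro ext) simp
next
  case (e_Bang P Q)
  then have "abs_pc (DBang P) = abs_pc (DBang Q)" by (simp add: abs_pc_eq_iff eqv.e_Bang)
  with e_Bang show ?case by (intro ext) simp
next
  case (e_Res P Q) then show ?case by (intro ext) (simp cong: vlab.case_cong)
qed auto

lemma tauc_eqv: "eqv P Q \<Longrightarrow> tauc P = tauc Q"
proof (induction rule: eqv.induct)
  case (e_extr P Q) show ?case by (rule tauc_extr)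
next
  case (e_swap P) 
  have "tauc (DRes (DRes P)) \<subseteq> tauc (DRes (DRes (rn sw P)))" for P
  proof
    fix X assume "X \<in> tauc (DRes (DRes P))"
    then obtain Y where Y: "Y \<in> tauc P" "X = qres (qres Y)" by auto
    then have "X = qres (qres (qrn sw Y))" by (simp add: qres_swap)
    with tauc_rn[OF Y(1)] show "X \<in> tauc (DRes (DRes (rn sw P)))" by auto
  qed
  from this[of P] this[of "rn sw P"] show ?case by (simp add: rn_rn subset_antisym)
next
  case (e_nil P) show ?case by (simp add: comm_def)
next
  case (e_comm P Q) show ?case by auto
next
  case (e_assoc P Q R) show ?case
    by (simp add: image_Un image_image comm_distribs ac_simps del: visc.simps)
next
  case (e_unfold P)
  have "X + abs_pc (DBang P) + abs_pc P = X + abs_pc (DBang P)" for X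
    using bang_unfold[of P] by (metis add.assoc add.commute)
  then show ?case by (simp add: image_Un image_image comm_distribs del: visc.simps)
next
  case (e_Par P P' Q Q')
  then have "abs_pc P = abs_pc P'" "abs_pc Q = abs_pc Q'" by (simp_all add: abs_pc_eq_iff)
  with e_Par show ?case by (simp add: visc_eqv)
next
  case (e_Bang P Q)
  then have "abs_pc (DBang P) = abs_pc (DBang Q)" by (simp add: abs_pc_eq_iff eqv.e_Bang)
  with e_Bang show ?case by (simp add: visc_eqv)
qed auto

section \<open>Transitions of classes, and commutation of outputs with inputs\<close>

lift_definition qvis :: "pc \<Rightarrow> vlab \<Rightarrow> pc set" is visc by (simp add: visc_eqv)
lift_definition qtau :: "pc \<Rightarrow> pc set" is tauc by (rule tauc_eqv)

lemma qvis_abs: "qvis (abs_pc P) = visc P"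
  by (simp add: qvis.abs_eq)

lemma qtau_abs: "qtau (abs_pc P) = tauc P"
  by (simp add: qtau.abs_eq)

lemma pc_cases: obtains P where "X = abs_pc P"
  by (metis Quotient_abs_rep Quotient_pc)

lemma qvis_add: "qvis (X + Y) l = (\<lambda>Z. Z + vsh l Y) ` qvis X l \<union> (\<lambda>Z. Z + vsh l X) ` qvis Y l"
  by (cases X rule: pc_cases; cases Y rule: pc_cases) (simp add: qvis_abs flip: abs_pc_simps(2))

lemma qvis_qres: "qvis (qres X) l = (\<lambda>X. qres (vsw l X)) ` qvis X (vmap Suc l) \<union>
     (case l of VBOut u \<Rightarrow> qvis X (VOut (Suc u) 0) | _ \<Rightarrow> {})"
  by (cases X rule: pc_cases) (simp add: qvis_abs flip: abs_pc_simps(3) cong: vlab.case_cong)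

lemma qtau_add: "qtau (X + Y) = (\<lambda>Z. Z + Y) ` qtau X \<union> (\<lambda>Z. Z + X) ` qtau Y \<union>
     comm (qvis X) (qvis Y) \<union> comm (qvis Y) (qvis X)"
  by (cases X rule: pc_cases; cases Y rule: pc_cases) (simp add: qvis_abs qtau_abs flip: abs_pc_simps(2))

lemma qtau_qres: "qtau (qres X) = qres ` qtau X"
  by (cases X rule: pc_cases) (simp add: qtau_abs flip: abs_pc_simps(3))

lemma qvis_rn: "X \<in> qvis S l \<Longrightarrow> vrn l f X \<in> qvis (qrn f S) (vmap f l)"
  by (cases S rule: pc_cases) (simp add: qvis_abs visc_rn flip: abs_pc_simps(4))

lemma qvis_rnD: "Y \<in> qvis (qrn f S) l' \<Longrightarrow> \<exists>l X. l' = vmap f l \<and> X \<in> qvis S l \<and> Y = vrn l f X"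
  using visc_rnD by (cases S rule: pc_cases) (simp add: qvis_abs flip: abs_pc_simps(4))

lemma qrn_Out: "qrn f (abs_pc (DOut u v)) = abs_pc (DOut (f u) (f v))"
  by (simp flip: abs_pc_simps(4))

text \<open>This is where asynchrony enters: an output has no continuation.\<close>

lemma visc_out_shape:
  "X \<in> visc P l \<Longrightarrow> (case l of VOut u v \<Rightarrow> abs_pc P = abs_pc (DOut u v) + X
     | VBOut u \<Rightarrow> abs_pc P = qres (abs_pc (DOut (Suc u) 0) + X) | VIn u \<Rightarrow> True)"
proof (induction P arbitrary: l X)
  case (DRes P)
  show ?case
  proof (cases l)
    case (VOut u v)
    with DRes.prems obtain Y where Y: "Y \<in> visc P (VOut (Suc u) (Suc v))" "X = qres Y" by (auto simp: vsw_def)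
    from DRes.IH[OF Y(1)] show ?thesis by (simp add: VOut Y add_qres qrn_Out)
  next
    case (VBOut u)
    with DRes.prems consider (a) Y where "Y \<in> visc P (VBOut (Suc u))" "X = qres (qrn sw Y)"
      | (b) "X \<in> visc P (VOut (Suc u) 0)" by (auto simp: vsw_def)
    then show ?thesis
    proof cases
      case a
      have "qres (qres (abs_pc (DOut (Suc (Suc u)) 0) + Y)) = qres (qres (qrn sw (abs_pc (DOut (Suc (Suc u)) 0) + Y)))"
        by (simp only: qres_swap)
      with DRes.IH[OF a(1)] show ?thesis by (simp add: VBOut a add_qres qrn_Out)
    next
      case b
      from DRes.IH[OF b] show ?thesis by (simp add: VBOut)
    qed
  qed simp
next
  case (DPar P Q)
  from DPar.prems consider (a) Y where "Y \<in> visc P l" "X = Y + vsh l (abs_pc Q)"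
    | (b) Y where "Y \<in> visc Q l" "X = Y + vsh l (abs_pc P)" by auto
  then show ?case
  proof cases
    case a
    from DPar.IH(1)[OF a(1)] show ?thesis by (simp add: a vsh_def qres_add add_qres ac_simps split: vlab.splits)
  next
    case b
    from DPar.IH(2)[OF b(1)] show ?thesis
      by (simp add: b vsh_def qres_add add_qres ac_simps split: vlab.splits)
  qed
next
  case (DBang P)
  from DBang.prems obtain Y where Y: "Y \<in> visc P l" "X = Y + vsh l (abs_pc (DBang P))" by auto
  from DBang.IH[OF Y(1)] show ?case
    by (subst (1 2) bang_unfold) (simp add: Y vsh_def qres_add add_qres ac_simps split: vlab.splits)
qed (auto split: if_splits)

lemma qvis_out_shape:
  "X \<in> qvis S (VOut u v) \<Longrightarrow> S = abs_pc (DOut u v) + X"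
  "X \<in> qvis S (VBOut u) \<Longrightarrow> S = qres (abs_pc (DOut (Suc u) 0) + X)"
  using visc_out_shape by (cases S rule: pc_cases; force simp: qvis_abs)+

lemma qvis_DOut: "qvis (abs_pc (DOut x y)) l = (if l = VOut x y then {0} else {})"
  by (simp add: qvis_abs)

text \<open>By \<open>qvis_out_shape\<close> the process is the output in parallel with
  \<open>X\<close>. An output cannot receive, so the input takes place in \<open>X\<close> and the
  two actions are independent. After the input the output label is shifted because index 0 awaits
  the received name.\<close>

lemma qvis_diamond_out:
  assumes "X \<in> qvis S (VOut u v)" "Y \<in> qvis S (VIn w)"
  shows "\<exists>Z. Z \<in> qvis X (VIn w) \<and> Z \<in> qvis Y (VOut (Suc u) (Suc v))"
proof -
  from assms(2)[unfolded qvis_out_shape(1)[OF assms(1)] qvis_add] obtain Z where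
    "Z \<in> qvis X (VIn w)" "Y = Z + abs_pc (DOut (Suc u) (Suc v))"
    by (auto simp: qvis_DOut vsh_def qrn_Out)
  then show ?thesis by (auto simp: qvis_add qvis_DOut vsh_def)
qed

text \<open>After both actions two names are pending. In \<open>Z\<close> the received name is index
  0 and the extruded one index 1; if the input comes first it is the other way round, hence
  \<open>qrn sw Z\<close>.\<close>

lemma qvis_diamond_bout:
  assumes "X \<in> qvis S (VBOut u)" "Y \<in> qvis S (VIn w)"
  shows "\<exists>Z. Z \<in> qvis X (VIn (Suc w)) \<and> qrn sw Z \<in> qvis Y (VBOut (Suc u))"
proof -
  from assms(2)[unfolded qvis_out_shape(2)[OF assms(1)] qvis_add qvis_qres] obtain Z where
    Z: "Z \<in> qvis X (VIn (Suc w))" and "Y = qres (qrn sw (Z + qrn Suc (abs_pc (DOut (Suc u) 0))))"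
    by (auto simp: qvis_DOut vsh_def vsw_def)
  then have "Y = qres (qrn sw Z + abs_pc (DOut (Suc (Suc u)) 0))" by (simp add: qrn_Out)
  then have "qrn sw Z \<in> qvis Y (VBOut (Suc u))" by (simp add: qvis_qres qvis_add qvis_DOut vsh_def)
  with Z show ?thesis by blast
qed

section \<open>Correspondence with the transitions of named processes\<close>

definition under :: "(name \<Rightarrow> nat) \<Rightarrow> name \<Rightarrow> name \<Rightarrow> nat" where
  "under e y = (Suc \<circ> e)(y := 0)"

lemma under_simps [simp]: "under e y y = 0" "x \<noteq> y \<Longrightarrow> under e y x = Suc (e x)"
  by (simp_all add: under_def)

lemma under_eq_0 [simp]: "under e y x = 0 \<longleftrightarrow> x = y" "0 = under e y x \<longleftrightarrow> x = y"
  by (simp_all add: under_def)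

lemma Suc_eq_under [simp]: "Suc n = under e y x \<longleftrightarrow> x \<noteq> y \<and> n = e x"
  by (simp add: under_def)

lemma inj_under: "inj e \<Longrightarrow> inj (under e y)"
  by (auto simp: inj_def under_def)

lemma comp_under: "up f \<circ> under e y = under (f \<circ> e) y" "inst (e y) \<circ> under e y = e"
  "z \<noteq> y \<Longrightarrow> sw \<circ> under (under e z) y = under (under e y) z"
  by (auto simp: under_def fun_eq_iff)

fun db :: "(name \<Rightarrow> nat) \<Rightarrow> proc \<Rightarrow> dproc" where
  "db e Nil = DNil"
| "db e (Out x y) = DOut (e x) (e y)"
| "db e (In x y P) = DIn (e x) (db (under e y) P)"
| "db e (Res x P) = DRes (db (under e x) P)"
| "db e (Par P Q) = DPar (db e P) (db e Q)"
| "db e (Bang P) = DBang (db e P)"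

lemma db_cong: "(\<And>x. x \<in> fnames P \<Longrightarrow> e x = f x) \<Longrightarrow> db e P = db f P"
proof (induction P arbitrary: e f)
  case (In x y P)
  have "db (under e y) P = db (under f y) P"
    by (rule In.IH) (use In.prems in \<open>auto simp: under_def\<close>)
  with In.prems show ?case by simp
next
  case (Res y P)
  have "db (under e y) P = db (under f y) P"
    by (rule Res.IH) (use Res.prems in \<open>auto simp: under_def\<close>)
  then show ?case by simp
next
  case (Par P Q)
  have "db e P = db f P" "db e Q = db f Q" by (rule Par.IH; use Par.prems in simp)+
  then show ?case by simp
next
  case (Bang P)
  have "db e P = db f P" by (rule Bang.IH) (use Bang.prems in simp)
  then show ?case by simp
qed simp_all

text \<open>Consequently, if a process is alpha-equivalent to a renaming of itself, that renaming
  fixes its free names; this is how the symmetry turns out to have period \<open>k\<close> on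
  them.\<close>

lemma db_eqD: "db e P = db f P \<Longrightarrow> x \<in> fnames P \<Longrightarrow> e x = f x"
proof (induction P arbitrary: e f)
  case (In z y P)
  then show ?case using In.IH[of "under e y" "under f y"] by (cases "x = y") auto
next
  case (Res y P)
  then show ?case using Res.IH[of "under e y" "under f y"] by (cases "x = y") auto
qed auto

lemma rn_db: "rn f (db e P) = db (f \<circ> e) P"
  by (induction P arbitrary: f e) (simp_all add: comp_under)

lemma dfn_db: "dfn (db e P) = e ` fnames P"
proof (induction P arbitrary: e)
  case (In x y P)
  have "Suc -` (under e y ` A) = e ` (A - {y})" for A by (auto simp: under_def image_iff split: if_splits)
  then show ?case by (simp add: In)
next
  case (Res y P)
  have "Suc -` (under e y ` A) = e ` (A - {y})" for A by (auto simp: under_def image_iff split: if_splits)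
  then show ?case by (simp add: Res)
qed auto

lemma finite_fnames: "finite (fnames P)"
  by (induction P) auto

lemma ex_Nm_notin: "finite (S :: name set) \<Longrightarrow> \<exists>n. Nm n \<notin> S"
proof -
  assume "finite S"
  then have "finite (Nm -` S)" by (rule finite_vimageI) (simp add: inj_def)
  then obtain n where "n \<notin> Nm -` S" using ex_new_if_finite infinite_UNIV_nat by blast
  then show ?thesis by auto
qed

lemma fresh_notin: "finite S \<Longrightarrow> fresh S \<notin> S"
  unfolding fresh_def by (rule LeastI_ex) (rule ex_Nm_notin)

text \<open>The fresh binders chosen by \<open>ren\<close> leave no trace, because a bound name
  becomes index 0 at its binder whatever it is called; only the composition of environments
  remains.\<close>

lemma db_ren: "db e (ren f P) = db (e \<circ> f) P"
proof (induction P arbitrary: e f)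
  case (In x y P)
  define z where "z = fresh (f ` (fnames P - {y}))"
  have z: "z \<notin> f ` (fnames P - {y})" unfolding z_def by (rule fresh_notin) (simp add: finite_fnames)
  have "db (under e z \<circ> f(y := z)) P = db (under (e \<circ> f) y) P"
    by (rule db_cong) (use z in \<open>auto simp: under_def\<close>)
  then show ?case by (simp only: ren.simps Let_def db.simps In.IH comp_def z_def[symmetric])
next
  case (Res y P)
  define z where "z = fresh (f ` (fnames P - {y}))"
  have z: "z \<notin> f ` (fnames P - {y})" unfolding z_def by (rule fresh_notin) (simp add: finite_fnames)
  have "db (under e z \<circ> f(y := z)) P = db (under (e \<circ> f) y) P"
    by (rule db_cong) (use z in \<open>auto simp: under_def\<close>)
  then show ?case by (simp only: ren.simps Let_def db.simps Res.IH comp_def z_def[symmetric])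
qed auto

lemma db_subst1_under: "z \<notin> fnames P - {y} \<Longrightarrow> db (under e z) (subst1 P z y) = db (under e y) P"
  unfolding subst1_def db_ren by (rule db_cong) (auto simp: under_def)

lemma db_alpha: "alpha P Q \<Longrightarrow> db e P = db e Q"
  by (induction arbitrary: e rule: alpha.induct) (simp_all add: db_subst1_under)

definition sem :: "(name \<Rightarrow> nat) \<Rightarrow> proc \<Rightarrow> pc" where
  "sem e P = abs_pc (db e P)"

lemma sem_simps [simp]: "sem e Nil = 0" "sem e (Par P Q) = sem e P + sem e Q"
  "sem e (Res x P) = qres (sem (under e x) P)"
  by (simp_all add: sem_def)

lemma qrn_sem: "qrn f (sem e P) = sem (f \<circ> e) P"
  by (simp add: sem_def rn_db flip: abs_pc_simps(4))

lemma sem_cong: "(\<And>x. x \<in> fnames P \<Longrightarrow> e x = f x) \<Longrightarrow> sem e P = sem f P"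
  by (simp add: sem_def cong: db_cong)

lemma sem_under: "y \<notin> fnames P \<Longrightarrow> sem (under e y) P = qrn Suc (sem e P)"
  unfolding qrn_sem by (rule sem_cong) (auto simp: under_def)

lemma sem_subst1: "sem e (subst1 P z y) = qrn (inst (e z)) (sem (under e y) P)"
  unfolding qrn_sem by (simp add: sem_def subst1_def db_ren) (rule arg_cong[of _ _ abs_pc], rule db_cong, simp add: under_def)

lemma sem_Bang: "sem e (Bang P) = sem e P + sem e (Bang P)"
  unfolding sem_def using bang_unfold by simp

text \<open>Classes are coarser than structural congruence; this inclusion is what the rule
  \<open>t_Cong\<close> requires.\<close>

lemma sem_scong: "scong P Q \<Longrightarrow> sem e P = sem e Q"
proof (induction arbitrary: e rule: scong.induct)
  case (s_alpha P Q) then show ?case by (simp add: sem_def db_alpha)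
next
  case (s_extr x Q P) then show ?case by (simp add: qres_add sem_under)
next
  case (s_cIn P Q x y)
  then have "eqv (db (under e y) P) (db (under e y) Q)" by (simp add: sem_def abs_pc_eq_iff)
  then show ?case by (simp add: sem_def abs_pc_eq_iff e_In)
next
  case (s_cBang P Q) then show ?case by (simp add: sem_def abs_pc_eq_iff e_Bang)
qed (auto simp: ac_simps)

lemma qfn_sem: "qfn (sem e P) = e ` fnames P"
  by (simp add: sem_def qfn.abs_eq dfn_db)

text \<open>The residues modulo 3 separate the three sorts of names.\<close>

fun enc :: "name \<Rightarrow> nat" where
  "enc (Num n) = 3 * n"
| "enc Obs = 1"
| "enc (Nm n) = 3 * n + 2"

lemma inj_enc: "inj enc"
proof (rule injI)
  fix x y assume "enc x = enc y"
  then show "x = y" by (cases x; cases y) (simp; presburger)+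
qed

lemma fnames_scong: "scong P Q \<Longrightarrow> fnames P = fnames Q"
  by (metis sem_scong qfn_sem inj_enc inj_image_eq_iff)

lemma fnames_ren: "fnames (ren f P) = f ` fnames P"
proof -
  have "enc ` fnames (ren f P) = enc ` f ` fnames P"
    by (metis db_ren dfn_db image_comp)
  then show ?thesis using inj_enc inj_image_eq_iff by metis
qed

lemma trans_bn_fresh: "trans P \<mu> P' \<Longrightarrow> act_bn \<mu> \<inter> fnames P = {}"
  by (induction rule: trans.induct) (auto simp: fnames_scong)

lemma trans_fnames:
  "trans P \<mu> P' \<Longrightarrow>
     (case \<mu> of Tau \<Rightarrow> True | OutA x y \<Rightarrow> x \<in> fnames P \<and> y \<in> fnames P
      | BOutA x y \<Rightarrow> x \<in> fnames P | InA x y \<Rightarrow> x \<in> fnames P)"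
  by (induction rule: trans.induct) (auto simp: fnames_scong split: act.splits)

lemma fnames_trans: "trans P \<mu> P' \<Longrightarrow> fnames P' \<subseteq> fnames P \<union> act_names \<mu>"
proof (induction rule: trans.induct)
  case (t_In x y P z)
  then show ?case by (auto simp: subst1_def fnames_ren)
next
  case (t_Cong P P1 \<mu> Q1 Q)
  then show ?case using fnames_scong by blast
next
  case (t_Com P x y P' Q Q')
  then show ?case using trans_fnames[OF t_Com.hyps(1)] by auto
next
  case (t_Close P x y P' Q Q')
  then show ?case using trans_fnames[OF t_Close.hyps(1)] by auto
qed auto

text \<open>\<open>trans\<close> is early and named, \<open>qvis\<close> late and nameless. The
  residual of an input is therefore a late residual instantiated with the received name, and that of
  a bound output is read with the extruded name as index 0.\<close>

fun estep :: "(name \<Rightarrow> nat) \<Rightarrow> pc \<Rightarrow> act \<Rightarrow> proc \<Rightarrow> bool" where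
  "estep e S Tau P' \<longleftrightarrow> sem e P' \<in> qtau S"
| "estep e S (OutA x y) P' \<longleftrightarrow> sem e P' \<in> qvis S (VOut (e x) (e y))"
| "estep e S (BOutA x y) P' \<longleftrightarrow> x \<noteq> y \<and> sem (under e y) P' \<in> qvis S (VBOut (e x))"
| "estep e S (InA x z) P' \<longleftrightarrow> (\<exists>X\<in>qvis S (VIn (e x)). sem e P' = qrn (inst (e z)) X)"

lemma sem_under_under: "y \<noteq> z \<Longrightarrow> sem (under (under e z) y) P = qrn sw (sem (under (under e y) z) P)"
  by (simp add: qrn_sem comp_under)

lemma trans_sound: "trans P \<mu> P' \<Longrightarrow> inj e \<Longrightarrow> estep e (sem e P) \<mu> P'"
proof (induction arbitrary: e rule: trans.induct)
  case (t_Out x y)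
  then show ?case by (simp add: sem_def qvis_DOut)
next
  case (t_In x y P z)
  then show ?case by (simp add: sem_subst1) (simp add: sem_def qvis_abs)
next
  case (t_Open P x y P')
  from t_Open.IH[OF inj_under[OF t_Open.prems], of y] t_Open.hyps(2) show ?case
    by (simp add: qvis_qres)
next
  case (t_Res P \<mu> P' y)
  note IH = t_Res.IH[OF inj_under[OF t_Res.prems], of y]
  show ?case
  proof (cases \<mu>)
    case Tau with IH show ?thesis by (simp add: qtau_qres)
  next
    case (OutA x z) with IH t_Res.hyps(2) show ?thesis by (auto simp: qvis_qres vsw_def)
  next
    case (BOutA x z) with IH t_Res.hyps(2) show ?thesis by (auto simp: qvis_qres vsw_def sem_under_under[of y z e P'])
  next
    case (InA x z)
    with IH t_Res.hyps(2) obtain X where "X \<in> qvis (sem (under e y) P) (VIn (Suc (e x)))"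
      "sem (under e y) P' = qrn (inst (Suc (e z))) X" by auto
    then show ?thesis unfolding InA
      by (auto simp: qvis_qres vsw_def qrn_qrn up_inst_sw intro!: bexI[of _ X])
  qed
next
  case (t_Par P \<mu> P' Q)
  note IH = t_Par.IH[OF t_Par.prems]
  show ?case
  proof (cases \<mu>)
    case Tau with IH show ?thesis by (simp add: qtau_add)
  next
    case (OutA x z) with IH show ?thesis by (auto simp: qvis_add vsh_def)
  next
    case (BOutA x z) with IH t_Par.hyps(2) show ?thesis by (force simp: qvis_add vsh_def sem_under)
  next
    case (InA x z)
    with IH obtain X where "X \<in> qvis (sem e P) (VIn (e x))" "sem e P' = qrn (inst (e z)) X" by auto
    then show ?thesis unfolding InA
      by (auto simp: qvis_add vsh_def qrn_inst_Suc intro!: bexI[of _ "X + qrn Suc (sem e Q)"])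
  qed
next
  case (t_Com P x y P' Q Q')
  from t_Com.IH(1)[OF t_Com.prems] t_Com.IH(2)[OF t_Com.prems]
  have "sem e (Par P' Q') \<in> comm (qvis (sem e P)) (qvis (sem e Q))" by (force simp: comm_def)
  then show ?case by (simp add: qtau_add)
next
  case (t_Close P x y P' Q Q')
  from t_Close.IH(1)[OF t_Close.prems]
  have 1: "x \<noteq> y" "sem (under e y) P' \<in> qvis (sem e P) (VBOut (e x))" by auto
  \<comment> \<open>The receiver is read with \<open>y\<close> as index 0. As \<open>y\<close> does
    not occur in it, its class is a shift, and receiving \<open>y\<close> gives back the late
    residual unchanged.\<close>
  from t_Close.IH(2)[OF inj_under[OF t_Close.prems], of y] t_Close.hyps(3) 1 obtain X where
    X: "X \<in> qvis (qrn Suc (sem e Q)) (VIn (Suc (e x)))" "sem (under e y) Q' = qrn (inst 0) X"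
    by (auto simp: sem_under)
  from qvis_rnD[OF X(1)] obtain l Z where Z: "VIn (Suc (e x)) = vmap Suc l" "Z \<in> qvis (sem e Q) l" "X = vrn l Suc Z"
    by blast
  from Z(1) have l: "l = VIn (e x)" by (cases l) auto
  with X(2) Z(3) have "sem (under e y) Q' = Z" by (simp add: vrn_def qrn_qrn inst_comp)
  with 1 Z l have "sem e (Res y (Par P' Q')) \<in> comm (qvis (sem e P)) (qvis (sem e Q))"
    by (auto simp: comm_def)
  then show ?case by (simp add: qtau_add)
next
  case (t_Rep P \<mu> P')
  then show ?case by (metis sem_Bang sem_simps(2))
next
  case (t_Cong P P1 \<mu> Q1 Q)
  have "sem e P = sem e P1" "sem f Q1 = sem f Q" for f using t_Cong.hyps by (simp_all add: sem_scong)
  with t_Cong.IH[OF t_Cong.prems] show ?case by (cases \<mu>) simp_all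
qed

section \<open>Nameless transitions are realised by named ones\<close>

lemma trans_Par_right: "trans Q \<mu> Q' \<Longrightarrow> act_bn \<mu> \<inter> fnames P = {} \<Longrightarrow> trans (Par P Q) \<mu> (Par P Q')"
  by (rule t_Cong[OF s_comm t_Par s_comm])

text \<open>Alpha-conversion gives the restriction a bound name of choice, so that the side
  conditions of \<open>t_Res\<close> and \<open>t_Open\<close> can be met for a prescribed name in
  the label.\<close>

lemma db_DRes_fresh:
  assumes "db e P = DRes M" "w \<notin> fnames P"
  shows "\<exists>P1. scong P (Res w P1) \<and> db (under e w) P1 = M"
proof -
  from assms(1) obtain y P0 where P: "P = Res y P0" "M = db (under e y) P0" by (cases P) auto
  with assms(2) have "w \<notin> fnames P0 - {y}" by auto
  then show ?thesis unfolding P by (blast intro: s_alpha a_Res db_subst1_under)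
qed

lemma trans_complete_out:
  "db e P = L \<Longrightarrow> X \<in> visc L (VOut u v) \<Longrightarrow>
     \<exists>x y P'. u = e x \<and> v = e y \<and> trans P (OutA x y) P' \<and> sem e P' = X"
proof (induction L arbitrary: P e X u v)
  case (DOut a b)
  then obtain x y where "P = Out x y" "a = e x" "b = e y" by (cases P) auto
  with DOut.prems show ?case by (intro exI[of _ x] exI[of _ y] exI[of _ Nil]) (auto intro: t_Out split: if_splits)
next
  case (DRes M)
  then obtain w P0 where P: "P = Res w P0" "db (under e w) P0 = M" by (cases P) auto
  from DRes.prems(2) obtain Y where Y: "Y \<in> visc M (VOut (Suc u) (Suc v))" "X = qres Y" by (auto simp: vsw_def)
  from DRes.IH[OF P(2) Y(1)] obtain x y P' where
    "x \<noteq> w" "y \<noteq> w" "u = e x" "v = e y" "trans P0 (OutA x y) P'" "sem (under e w) P' = Y" by auto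
  moreover then have "trans P (OutA x y) (Res w P')" unfolding P by (intro t_Res) auto
  ultimately show ?case using Y by force
next
  case (DPar M N)
  then obtain P1 P2 where P: "P = Par P1 P2" "db e P1 = M" "db e P2 = N" by (cases P) auto
  from DPar.prems(2) consider (a) Y where "Y \<in> visc M (VOut u v)" "X = Y + sem e P2"
    | (b) Y where "Y \<in> visc N (VOut u v)" "X = sem e P1 + Y" by (auto simp: vsh_def P sem_def add.commute)
  then show ?case
  proof cases
    case a
    from DPar.IH(1)[OF P(2) a(1)] obtain x y P' where
      1: "u = e x" "v = e y" "trans P1 (OutA x y) P'" "sem e P' = Y" by auto
    then have "trans P (OutA x y) (Par P' P2)" unfolding P by (intro t_Par) auto
    with 1 a show ?thesis by force
  next
    case b
    from DPar.IH(2)[OF P(3) b(1)] obtain x y P' where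
      1: "u = e x" "v = e y" "trans P2 (OutA x y) P'" "sem e P' = Y" by auto
    then have "trans P (OutA x y) (Par P1 P')" unfolding P by (intro trans_Par_right) auto
    with 1 b show ?thesis by force
  qed
next
  case (DBang M)
  then obtain P0 where P: "P = Bang P0" "db e P0 = M" by (cases P) auto
  from DBang.prems(2) obtain Y where Y: "Y \<in> visc M (VOut u v)" "X = Y + sem e (Bang P0)"
    by (auto simp: vsh_def P sem_def)
  from DBang.IH[OF P(2) Y(1)] obtain x y P' where
      1: "u = e x" "v = e y" "trans P0 (OutA x y) P'" "sem e P' = Y" by auto
  then have "trans P (OutA x y) (Par P' (Bang P0))" unfolding P by (intro t_Rep t_Par) auto
  with 1 Y show ?case by force
qed (auto split: if_splits)

text \<open>The received name \<open>z\<close> is prescribed and may coincide with a bound name, so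
  restrictions are first renamed away from it. For a free output the label itself excludes the bound
  name.\<close>

lemma trans_complete_in:
  "db e P = L \<Longrightarrow> X \<in> visc L (VIn u) \<Longrightarrow>
     \<exists>x P'. u = e x \<and> trans P (InA x z) P' \<and> sem e P' = qrn (inst (e z)) X"
proof (induction L arbitrary: P e X u)
  case (DIn a M)
  then obtain x y P0 where "P = In x y P0" "a = e x" "M = db (under e y) P0" by (cases P) auto
  with DIn.prems show ?case
    by (intro exI[of _ x] exI[of _ "subst1 P0 z y"]) (auto simp: sem_subst1 simp flip: sem_def intro: t_In split: if_splits)
next
  case (DRes M)
  obtain w where w: "w \<notin> insert z (fnames P)"
    using ex_Nm_notin[of "insert z (fnames P)"] finite_fnames by blast
  then obtain P1 where P1: "scong P (Res w P1)" "db (under e w) P1 = M"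
    using db_DRes_fresh[OF DRes.prems(1), of w] by blast
  from DRes.prems(2) obtain Y where Y: "Y \<in> visc M (VIn (Suc u))" "X = qres (qrn sw Y)" by (auto simp: vsw_def)
  from DRes.IH[OF P1(2) Y(1)] w obtain x P' where
    1: "x \<noteq> w" "u = e x" "trans P1 (InA x z) P'" "sem (under e w) P' = qrn (inst (Suc (e z))) Y" by auto
  then have "trans (Res w P1) (InA x z) (Res w P')" using w by (intro t_Res) auto
  then have "trans P (InA x z) (Res w P')" using P1(1) by (blast intro: t_Cong s_alpha a_refl)
  with 1 show ?case by (force simp: Y qrn_qrn up_inst_sw)
next
  case (DPar M N)
  then obtain P1 P2 where P: "P = Par P1 P2" "db e P1 = M" "db e P2 = N" by (cases P) auto
  from DPar.prems(2) consider (a) Y where "Y \<in> visc M (VIn u)" "X = Y + qrn Suc (sem e P2)"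
    | (b) Y where "Y \<in> visc N (VIn u)" "X = qrn Suc (sem e P1) + Y" by (auto simp: vsh_def P sem_def add.commute)
  then show ?case
  proof cases
    case a
    from DPar.IH(1)[OF P(2) a(1)] obtain x P' where
      1: "u = e x" "trans P1 (InA x z) P'" "sem e P' = qrn (inst (e z)) Y" by auto
    then have "trans P (InA x z) (Par P' P2)" unfolding P by (intro t_Par) auto
    with 1 a show ?thesis by (force simp: qrn_inst_Suc)
  next
    case b
    from DPar.IH(2)[OF P(3) b(1)] obtain x P' where
      1: "u = e x" "trans P2 (InA x z) P'" "sem e P' = qrn (inst (e z)) Y" by auto
    then have "trans P (InA x z) (Par P1 P')" unfolding P by (intro trans_Par_right) auto
    with 1 b show ?thesis by (force simp: qrn_inst_Suc)
  qed
next
  case (DBang M)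
  then obtain P0 where P: "P = Bang P0" "db e P0 = M" by (cases P) auto
  from DBang.prems(2) obtain Y where Y: "Y \<in> visc M (VIn u)" "X = Y + qrn Suc (sem e (Bang P0))"
    by (auto simp: vsh_def P sem_def)
  from DBang.IH[OF P(2) Y(1)] obtain x P' where
      1: "u = e x" "trans P0 (InA x z) P'" "sem e P' = qrn (inst (e z)) Y" by auto
  then have "trans P (InA x z) (Par P' (Bang P0))" unfolding P by (intro t_Rep t_Par) auto
  with 1 Y show ?case by (force simp: qrn_inst_Suc)
qed (auto split: if_splits)

lemma trans_complete_bout:
  "db e P = L \<Longrightarrow> X \<in> visc L (VBOut u) \<Longrightarrow> y \<notin> fnames P \<Longrightarrow>
     \<exists>x P'. u = e x \<and> trans P (BOutA x y) P' \<and> sem (under e y) P' = X"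
proof (induction L arbitrary: P e X u)
  case (DRes M)
  from DRes.prems(2) consider (a) "X \<in> visc M (VOut (Suc u) 0)"
    | (b) Y where "Y \<in> visc M (VBOut (Suc u))" "X = qres (qrn sw Y)" by (auto simp: vsw_def)
  then show ?case
  proof cases
    case a
    \<comment> \<open>The restriction that is opened takes the prescribed name \<open>y\<close>; in
      the other case it must be kept away from \<open>y\<close>.\<close>
    obtain P1 where P1: "scong P (Res y P1)" "db (under e y) P1 = M"
      using db_DRes_fresh[OF DRes.prems(1,3)] by blast
    from trans_complete_out[OF P1(2) a] obtain x P' where
      1: "x \<noteq> y" "u = e x" "trans P1 (OutA x y) P'" "sem (under e y) P' = X" by auto
    then have "trans P (BOutA x y) P'" using P1(1) by (blast intro: t_Open t_Cong s_alpha a_refl)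
    with 1 show ?thesis by blast
  next
    case b
    obtain w where w: "w \<notin> insert y (fnames P)"
      using ex_Nm_notin[of "insert y (fnames P)"] finite_fnames by blast
    then obtain P1 where P1: "scong P (Res w P1)" "db (under e w) P1 = M"
      using db_DRes_fresh[OF DRes.prems(1), of w] by blast
    have "y \<notin> fnames P1" using fnames_scong[OF P1(1)] DRes.prems(3) w by auto
    from DRes.IH[OF P1(2) b(1) this] w obtain x P' where
      1: "x \<noteq> w" "u = e x" "trans P1 (BOutA x y) P'" "sem (under (under e w) y) P' = Y" by auto
    then have "trans (Res w P1) (BOutA x y) (Res w P')" using w by (intro t_Res) auto
    then have "trans P (BOutA x y) (Res w P')" using P1(1) by (blast intro: t_Cong s_alpha a_refl)
    moreover have "sem (under e y) (Res w P') = X"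
      using w 1(4) sem_under_under[of w y e P'] by (simp add: b)
    ultimately show ?thesis using 1 by blast
  qed
next
  case (DPar M N)
  then obtain P1 P2 where P: "P = Par P1 P2" "db e P1 = M" "db e P2 = N" by (cases P) auto
  with DPar.prems(3) have y: "y \<notin> fnames P1" "y \<notin> fnames P2" by auto
  from DPar.prems(2) consider (a) Y where "Y \<in> visc M (VBOut u)" "X = Y + qrn Suc (sem e P2)"
    | (b) Y where "Y \<in> visc N (VBOut u)" "X = qrn Suc (sem e P1) + Y" by (auto simp: vsh_def P sem_def add.commute)
  then show ?case
  proof cases
    case a
    from DPar.IH(1)[OF P(2) a(1) y(1)] obtain x P' where
      1: "u = e x" "trans P1 (BOutA x y) P'" "sem (under e y) P' = Y" by auto
    then have "trans P (BOutA x y) (Par P' P2)" unfolding P using y by (intro t_Par) auto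
    with 1 a y show ?thesis by (force simp: sem_under)
  next
    case b
    from DPar.IH(2)[OF P(3) b(1) y(2)] obtain x P' where
      1: "u = e x" "trans P2 (BOutA x y) P'" "sem (under e y) P' = Y" by auto
    then have "trans P (BOutA x y) (Par P1 P')" unfolding P using y by (intro trans_Par_right) auto
    with 1 b y show ?thesis by (force simp: sem_under)
  qed
next
  case (DBang M)
  then obtain P0 where P: "P = Bang P0" "db e P0 = M" by (cases P) auto
  with DBang.prems(3) have y: "y \<notin> fnames P0" by auto
  from DBang.prems(2) obtain Y where Y: "Y \<in> visc M (VBOut u)" "X = Y + qrn Suc (sem e (Bang P0))"
    by (auto simp: vsh_def P sem_def)
  from DBang.IH[OF P(2) Y(1) y] obtain x P' where
      1: "u = e x" "trans P0 (BOutA x y) P'" "sem (under e y) P' = Y" by auto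
  then have "trans P (BOutA x y) (Par P' (Bang P0))" unfolding P using y by (intro t_Rep t_Par) auto
  with 1 Y y show ?case by (force simp: sem_under)
qed (auto split: if_splits)

lemma trans_complete_comm:
  assumes "inj e" "X \<in> comm (visc (db e P)) (visc (db e Q))"
  shows "\<exists>R. trans (Par P Q) Tau R \<and> sem e R = X"
proof -
  from assms(2) consider (a) u v Y Z where "Y \<in> visc (db e P) (VOut u v)" "Z \<in> visc (db e Q) (VIn u)" "X = Y + qrn (inst v) Z"
    | (b) u Y Z where "Y \<in> visc (db e P) (VBOut u)" "Z \<in> visc (db e Q) (VIn u)" "X = qres (Y + Z)"
    by (auto simp: comm_def)
  then show ?thesis
  proof cases
    case a
    from trans_complete_out[OF refl a(1)] obtain x y P' where
      1: "u = e x" "v = e y" "trans P (OutA x y) P'" "sem e P' = Y" by blast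
    from trans_complete_in[OF refl a(2), of y] 1 assms(1) obtain Q' where
      2: "trans Q (InA x y) Q'" "sem e Q' = qrn (inst v) Z" by (auto dest: injD)
    from t_Com[OF 1(3) 2(1)] 1 2 a show ?thesis by force
  next
    case b
    obtain y where y: "y \<notin> fnames P \<union> fnames Q"
      using ex_Nm_notin[of "fnames P \<union> fnames Q"] finite_fnames by blast
    then obtain x P' where 1: "u = e x" "trans P (BOutA x y) P'" "sem (under e y) P' = Y"
      using trans_complete_bout[OF refl b(1), of y] by blast
    have "db (under e y) Q = rn Suc (db e Q)"
      unfolding rn_db by (rule db_cong) (use y in \<open>auto simp: under_def\<close>)
    then have "qrn (up Suc) Z \<in> visc (db (under e y) Q) (VIn (Suc u))"
      using visc_rn[OF b(2), of Suc] by (simp add: vrn_def)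
    from trans_complete_in[OF refl this, of y] 1 assms(1) obtain Q' where
      2: "trans Q (InA x y) Q'" "sem (under e y) Q' = Z" by (auto simp: qrn_qrn inst_comp dest: injD)
    have "trans (Par P Q) Tau (Res y (Par P' Q'))" using t_Close[OF 1(2) 2(1)] y by blast
    with 1 2 b show ?thesis by force
  qed
qed

lemma trans_complete_tau:
  "db e P = L \<Longrightarrow> inj e \<Longrightarrow> X \<in> tauc L \<Longrightarrow> \<exists>P'. trans P Tau P' \<and> sem e P' = X"
proof (induction L arbitrary: P e X)
  case (DRes M)
  then obtain w P0 where P: "P = Res w P0" "db (under e w) P0 = M" by (cases P) auto
  from DRes.prems(3) obtain Y where Y: "Y \<in> tauc M" "X = qres Y" by auto
  from DRes.IH[OF P(2) inj_under[OF DRes.prems(2)] Y(1)] obtain P' where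
    1: "trans P0 Tau P'" "sem (under e w) P' = Y" by blast
  then have "trans P Tau (Res w P')" unfolding P by (intro t_Res) auto
  with 1 Y show ?case by force
next
  case (DPar M N)
  then obtain P1 P2 where P: "P = Par P1 P2" "db e P1 = M" "db e P2 = N" by (cases P) auto
  from DPar.prems(3) consider (a) Y where "Y \<in> tauc M" "X = Y + sem e P2"
    | (b) Y where "Y \<in> tauc N" "X = sem e P1 + Y"
    | (c) "X \<in> comm (visc (db e P1)) (visc (db e P2))" | (d) "X \<in> comm (visc (db e P2)) (visc (db e P1))"
    by (auto simp: P sem_def add.commute)
  then show ?case
  proof cases
    case a
    from DPar.IH(1)[OF P(2) DPar.prems(2) a(1)] obtain P' where 1: "trans P1 Tau P'" "sem e P' = Y" by blast
    then have "trans P Tau (Par P' P2)" unfolding P by (intro t_Par) auto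
    with 1 a show ?thesis by force
  next
    case b
    from DPar.IH(2)[OF P(3) DPar.prems(2) b(1)] obtain P' where 1: "trans P2 Tau P'" "sem e P' = Y" by blast
    then have "trans P Tau (Par P1 P')" unfolding P by (intro trans_Par_right) auto
    with 1 b show ?thesis by force
  next
    case c
    from trans_complete_comm[OF DPar.prems(2) c] show ?thesis by (simp add: P)
  next
    case d
    from trans_complete_comm[OF DPar.prems(2) d] show ?thesis unfolding P
      by (blast intro: t_Cong s_comm s_alpha a_refl)
  qed
next
  case (DBang M)
  then obtain P0 where P: "P = Bang P0" "db e P0 = M" by (cases P) auto
  from DBang.prems(3) obtain Y where Y: "X = Y + sem e (Bang P0)" "Y \<in> tauc M \<union> comm (visc M) (visc M)"
    by (auto simp: P sem_def)
  from Y(2) show ?case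
  proof
    assume "Y \<in> tauc M"
    from DBang.IH[OF P(2) DBang.prems(2) this] obtain P' where 1: "trans P0 Tau P'" "sem e P' = Y" by blast
    then have "trans P Tau (Par P' (Bang P0))" unfolding P by (intro t_Rep t_Par) auto
    with 1 Y show ?thesis by force
  next
    assume "Y \<in> comm (visc M) (visc M)"
    \<comment> \<open>A communication of two copies is recast as one between a copy and the
      replication itself, the form to which \<open>t_Rep\<close> applies.\<close>
    then have "X \<in> comm (visc (db e P0)) (visc (db e (Bang P0)))"
      unfolding db.simps visc_Bang comm_shift2 by (simp add: Y P sem_def)
    from trans_complete_comm[OF DBang.prems(2) this] show ?thesis unfolding P by (blast intro: t_Rep)
  qed
qed (auto split: if_splits)

section \<open>Transfer of transitions between environments\<close>

lemma sem_inst_under: "qrn (inst (e y)) (sem (under e y) P) = sem e P"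
  by (simp add: qrn_sem comp_under)

fun ract :: "(name \<Rightarrow> name) \<Rightarrow> act \<Rightarrow> act" where
  "ract g Tau = Tau"
| "ract g (OutA x y) = OutA (g x) (g y)"
| "ract g (BOutA x y) = BOutA (g x) (g y)"
| "ract g (InA x y) = InA (g x) (g y)"

text \<open>Actions of processes that are read in different environments match if their codes agree.\<close>

fun act_code :: "(name \<Rightarrow> nat) \<Rightarrow> act \<Rightarrow> nat \<times> nat \<times> nat" where
  "act_code e Tau = (0, 0, 0)"
| "act_code e (OutA x y) = (1, e x, e y)"
| "act_code e (BOutA x y) = (2, e x, e y)"
| "act_code e (InA x y) = (3, e x, e y)"

text \<open>Soundness leads from \<open>P\<close> to the common class, completeness from there to
  \<open>Q\<close>. Allowing two environments covers congruence and renaming at once.\<close>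

lemma trans_transfer:
  assumes "inj e" "inj f" "sem e P = sem f Q" "trans P \<mu> P'" "act_code e \<mu> = act_code f \<mu>'"
  shows "\<exists>Q'. trans Q \<mu>' Q' \<and> sem e P' = sem f Q'"
proof -
  have st: "estep e (sem f Q) \<mu> P'" using trans_sound[OF assms(4,1)] assms(3) by simp
  have q: "qvis (sem f Q) = visc (db f Q)" "qtau (sem f Q) = tauc (db f Q)"
    by (simp_all add: sem_def qvis_abs qtau_abs)
  show ?thesis
  proof (cases \<mu>)
    case Tau
    with assms(5) have "\<mu>' = Tau" by (cases \<mu>') auto
    with st Tau trans_complete_tau[OF refl assms(2)] show ?thesis by (fastforce simp: q)
  next
    case (OutA x y)
    with assms(5) obtain x' y' where m: "\<mu>' = OutA x' y'" "e x = f x'" "e y = f y'" by (cases \<mu>') auto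
    from st OutA m have "sem e P' \<in> visc (db f Q) (VOut (f x') (f y'))" by (simp add: q)
    from trans_complete_out[OF refl this] assms(2) show ?thesis by (metis m(1) injD)
  next
    case (BOutA x y)
    with assms(5) obtain x' y' where m: "\<mu>' = BOutA x' y'" "e x = f x'" "e y = f y'" by (cases \<mu>') auto
    from st BOutA m have 1: "sem (under e y) P' \<in> visc (db f Q) (VBOut (f x'))" by (simp add: q)
    have "y \<notin> fnames P" using trans_bn_fresh[OF assms(4)] BOutA by simp
    then have "y' \<notin> fnames Q" using assms(1,2,3) m qfn_sem[of e P] qfn_sem[of f Q]
      by (metis image_eqI inj_image_mem_iff)
    from trans_complete_bout[OF refl 1 this] assms(2) obtain Q' where
      2: "trans Q \<mu>' Q'" "sem (under f y') Q' = sem (under e y) P'" by (metis m(1) injD)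
    then have "sem e P' = sem f Q'" by (metis m(3) sem_inst_under)
    with 2 show ?thesis by blast
  next
    case (InA x y)
    with assms(5) obtain x' y' where m: "\<mu>' = InA x' y'" "e x = f x'" "e y = f y'" by (cases \<mu>') auto
    from st InA m obtain X where X: "X \<in> visc (db f Q) (VIn (f x'))" "sem e P' = qrn (inst (f y')) X" by (auto simp: q)
    from trans_complete_in[OF refl X(1), of y'] assms(2) X(2) m show ?thesis by (metis injD)
  qed
qed

lemma act_code_ract: "act_code (e \<circ> g) \<mu> = act_code e (ract g \<mu>)"
  by (cases \<mu>) auto

lemma trans_transfer_ren:
  assumes "inj g" "sem enc P = sem (enc \<circ> g) Q"
  shows "trans P (ract g \<mu>) P' \<Longrightarrow> \<exists>Q'. trans Q \<mu> Q' \<and> sem enc P' = sem (enc \<circ> g) Q'"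
    and "trans Q \<mu> Q' \<Longrightarrow> \<exists>P'. trans P (ract g \<mu>) P' \<and> sem enc P' = sem (enc \<circ> g) Q'"
proof -
  have i: "inj (enc \<circ> g)" using inj_enc assms(1) by (rule inj_compose)
  show "trans P (ract g \<mu>) P' \<Longrightarrow> \<exists>Q'. trans Q \<mu> Q' \<and> sem enc P' = sem (enc \<circ> g) Q'"
    by (rule trans_transfer[OF inj_enc i assms(2)]) (simp_all add: act_code_ract)
  show "trans Q \<mu> Q' \<Longrightarrow> \<exists>P'. trans P (ract g \<mu>) P' \<and> sem enc P' = sem (enc \<circ> g) Q'"
    using trans_transfer[OF i inj_enc assms(2)[symmetric], of \<mu> Q' "ract g \<mu>"] by (auto simp: act_code_ract)
qed

lemma trans_bout_rename:
  assumes "trans P (BOutA x y) P'" "y' \<notin> fnames P"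
  shows "\<exists>P''. trans P (BOutA x y') P''"
proof -
  from trans_sound[OF assms(1) inj_enc] have "sem (under enc y) P' \<in> visc (db enc P) (VBOut (enc x))"
    by (simp add: sem_def qvis_abs)
  from trans_complete_bout[OF refl this assms(2)] show ?thesis using inj_enc by (metis injD)
qed

lemma trans_in_rename:
  assumes "trans P (InA x z) P'"
  shows "\<exists>P''. trans P (InA x z') P''"
proof -
  from trans_sound[OF assms(1) inj_enc] obtain X where "X \<in> visc (db enc P) (VIn (enc x))"
    by (auto simp: sem_def qvis_abs)
  from trans_complete_in[OF refl this, of z'] show ?thesis using inj_enc by (metis injD)
qed

lemma sem_eq_any_env:
  assumes "inj e" "sem e P = sem e Q"
  shows "sem f P = sem f Q"
proof -
  have "(f \<circ> inv e) \<circ> e = f" using assms(1) by (simp add: fun_eq_iff)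
  then show ?thesis using assms(2) qrn_sem[of "f \<circ> inv e" e] by metis
qed

text \<open>Named form of the two diamonds. If the extruded name were also the one received,
  receiving first could make it free and block the extrusion; hence
  \<open>y \<noteq> z\<close>.\<close>

lemma trans_out_in_diamond:
  assumes "\<alpha> = OutA x y \<or> \<alpha> = BOutA x y \<and> y \<noteq> a \<and> y \<noteq> z"
    and "trans P \<alpha> P1" "trans P (InA a z) P2"
  shows "\<exists>Q1 Q2. trans P1 (InA a z) Q1 \<and> trans P2 \<alpha> Q2 \<and> sem enc Q1 = sem enc Q2"
proof -
  let ?e = enc
  note inj = injD[OF inj_enc]
  have q: "qvis (sem f Q) = visc (db f Q)" for f Q by (simp add: sem_def qvis_abs)
  from trans_sound[OF assms(3) inj_enc] obtain L2 where
    L2: "L2 \<in> qvis (sem ?e P) (VIn (?e a))" "sem ?e P2 = qrn (inst (?e z)) L2" by auto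
  from assms(1) show ?thesis
  proof
    assume al: "\<alpha> = OutA x y"
    from trans_sound[OF assms(2) inj_enc] al have 1: "sem ?e P1 \<in> qvis (sem ?e P) (VOut (?e x) (?e y))" by simp
    from qvis_diamond_out[OF 1 L2(1)] obtain Z where
      Z: "Z \<in> visc (db ?e P1) (VIn (?e a))" "Z \<in> qvis L2 (VOut (Suc (?e x)) (Suc (?e y)))" by (auto simp: q)
    from trans_complete_in[OF refl Z(1), of z] obtain Q1 where
      Q1: "trans P1 (InA a z) Q1" "sem ?e Q1 = qrn (inst (?e z)) Z" using inj by metis
    have "qrn (inst (?e z)) Z \<in> visc (db ?e P2) (VOut (?e x) (?e y))"
      using qvis_rn[OF Z(2), of "inst (?e z)"] by (simp add: vrn_def L2(2)[symmetric] q)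
    from trans_complete_out[OF refl this] obtain Q2 where
      "trans P2 (OutA x y) Q2" "sem ?e Q2 = qrn (inst (?e z)) Z" using inj by metis
    with Q1 al show ?thesis by metis
  next
    assume al: "\<alpha> = BOutA x y \<and> y \<noteq> a \<and> y \<noteq> z"
    from trans_sound[OF assms(2) inj_enc] al have 1: "sem (under ?e y) P1 \<in> qvis (sem ?e P) (VBOut (?e x))" by simp
    from qvis_diamond_bout[OF 1 L2(1)] obtain Z where
      Z: "Z \<in> visc (db (under ?e y) P1) (VIn (Suc (?e a)))" "qrn sw Z \<in> qvis L2 (VBOut (Suc (?e x)))" by (auto simp: q)
    from trans_complete_in[OF refl Z(1), of z] al obtain Q1 where
      Q1: "trans P1 (InA a z) Q1" "sem (under ?e y) Q1 = qrn (inst (Suc (?e z))) Z"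
      by (auto dest!: inj)
    have "qrn (up (inst (?e z))) (qrn sw Z) \<in> visc (db ?e P2) (VBOut (?e x))"
      using qvis_rn[OF Z(2), of "inst (?e z)"] by (simp add: vrn_def L2(2)[symmetric] q)
    then have 2: "qrn (inst (Suc (?e z))) Z \<in> visc (db ?e P2) (VBOut (?e x))"
      by (simp add: qrn_qrn up_inst_sw)
    have "y \<notin> fnames P2" using trans_bn_fresh[OF assms(2)] fnames_trans[OF assms(3)] al by auto
    from trans_complete_bout[OF refl 2 this] obtain Q2 where
      Q2: "trans P2 (BOutA x y) Q2" "sem (under ?e y) Q2 = qrn (inst (Suc (?e z))) Z" using inj by metis
    have "sem ?e Q1 = sem ?e Q2" using sem_inst_under[of ?e y] Q1(2) Q2(2) by metis
    with Q1 Q2 al show ?thesis by metis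
  qed
qed

section \<open>Symmetric rounds\<close>

text \<open>A renaming of names induces a renaming \<open>h'\<close> of their codes, which is then
  applied to both classes.\<close>

lemma sem_ren_trans:
  assumes "sem enc P = sem (enc \<circ> g) Q"
  shows "sem (enc \<circ> h) P = sem (enc \<circ> (h \<circ> g)) Q"
proof -
  define h' where "h' = enc \<circ> h \<circ> inv enc"
  have 1: "h' \<circ> enc = enc \<circ> h" unfolding h'_def using inj_enc by (simp add: fun_eq_iff)
  then have 2: "h' \<circ> (enc \<circ> g) = enc \<circ> (h \<circ> g)" by (simp add: comp_assoc[symmetric])
  show ?thesis using assms qrn_sem[of h' enc P] qrn_sem[of h' "enc \<circ> g" Q] unfolding 1 2 by simp
qed

lemma act_names_ract [simp]: "act_names (ract g \<mu>) = g ` act_names \<mu>" "act_bn (ract g \<mu>) = g ` act_bn \<mu>"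
  by (cases \<mu>; simp)+

lemma ract_ract: "ract g (ract h \<mu>) = ract (g \<circ> h) \<mu>"
  by (cases \<mu>) auto

lemma ract_id [simp]: "ract id \<mu> = \<mu>"
  by (cases \<mu>) auto

text \<open>Outputs consumed in a communication count as well, since projections record the premise
  contributed by the sender.\<close>

definition emits :: "nat \<Rightarrow> nlab \<Rightarrow> nat \<Rightarrow> bool" where
  "emits k l n \<longleftrightarrow> (\<exists>i\<in>{1..k}. contrib i l = Some (OutA Obs (Num n)))"

lemma chain_steps:
  assumes "I 0 S" and "\<And>t S. t < n \<Longrightarrow> I t S \<Longrightarrow> \<exists>S'. R t S S' \<and> I (Suc t) S'"
  shows "\<exists>st. st 0 = S \<and> (\<forall>t<n. R t (st t) (st (Suc t))) \<and> I n (st n)"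
  using assms(2)
proof (induction n)
  case 0
  then show ?case using assms(1) by auto
next
  case (Suc n)
  then obtain st where st: "st 0 = S" "\<forall>t<n. R t (st t) (st (Suc t))" "I n (st n)" by force
  from Suc.prems[OF lessI st(3)] obtain S' where "R n (st n) S'" "I (Suc n) S'" by blast
  with st show ?case by (intro exI[of _ "st(Suc n := S')"]) (auto simp: less_Suc_eq)
qed

text \<open>The nodes in cyclic order are \<open>\<nu> 0, \<nu> 1, \<dots>\<close>. By \<open>fresh_cycle\<close> the names
  extruded in a round can be chosen as one full orbit of unused names, so that the same \<open>s\<close> serves
  for the whole computation and need not be extended by the new names.\<close>

locale ring_symmetry =
  fixes k :: nat and s :: "name \<Rightarrow> name" and \<nu> :: "nat \<Rightarrow> nat"
  assumes k2: "2 \<le> k"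
    and s_pow: "s ^^ k = id"
    and nu_in: "\<nu> m \<in> {1..k}"
    and nu_eq: "\<nu> m = \<nu> m' \<longleftrightarrow> m mod k = m' mod k"
    and nu_surj: "i \<in> {1..k} \<Longrightarrow> \<exists>m. \<nu> m = i"
    and s_Obs: "s Obs = Obs"
    and s_Num: "s (Num (\<nu> m)) = Num (\<nu> (Suc m))"
    and fresh_cycle: "finite F \<Longrightarrow> \<exists>y. \<forall>t. (s ^^ t) y \<notin> F \<and> ((s ^^ t) y = y \<longrightarrow> t mod k = 0)"
begin

section \<open>Positions on the ring and symmetric states\<close>

lemma s_pow_mod: "s ^^ (m mod k) = s ^^ m"
proof -
  have "s ^^ (k * q) = id" for q by (simp add: funpow_mult[symmetric] s_pow id_def[symmetric] id_funpow)
  moreover have "s ^^ m = s ^^ (m mod k) \<circ> s ^^ (k * (m div k))" by (simp flip: funpow_add)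
  ultimately show ?thesis by simp
qed

lemma inj_s: "inj s"
proof (rule injI)
  fix x y assume "s x = s y"
  then have "(s ^^ (k - 1)) (s x) = (s ^^ (k - 1)) (s y)" by simp
  moreover have "(s ^^ (k - 1)) (s x) = x" for x
    using s_pow k2 funpow_swap1[of s "k - 1" x] by (cases k) (auto simp: fun_eq_iff)
  ultimately show "x = y" by simp
qed

lemma inj_s_pow: "inj (s ^^ m)"
  using inj_s by (rule inj_fn)

lemma s_pow_eq:
  assumes "\<forall>t. (s ^^ t) y = y \<longrightarrow> t mod k = 0" "(s ^^ t) y = (s ^^ u) y" "t < k" "u < k"
  shows "t = u"
  using assms(2-)
proof (induction t u rule: linorder_wlog)
  case (le t u)
  have "(s ^^ u) y = (s ^^ t) ((s ^^ (u - t)) y)"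
    using le(1) by (metis comp_apply funpow_add le_add_diff_inverse)
  with le inj_s_pow[of t] have "(s ^^ (u - t)) y = y" by (metis injD)
  with assms(1) have "(u - t) mod k = 0" by blast
  with le show ?case by simp
next
  case (sym t u)
  then show ?case by auto
qed

lemma nu_mod: "\<nu> (a + m mod k) = \<nu> (a + m)"
  by (simp add: nu_eq mod_add_right_eq)

definition csym :: "(nat \<Rightarrow> proc) \<Rightarrow> bool" where
  "csym C \<longleftrightarrow> (\<forall>a m. sem enc (C (\<nu> (a + m))) = sem (enc \<circ> s ^^ m) (C (\<nu> a)))"

lemma nu_shift: "\<exists>u<k. \<nu> b = \<nu> (a + u)"
proof -
  have "a + (b + (k - 1) * a) = b + k * a" using k2 by (cases k) auto
  then have "(a + (b + (k - 1) * a)) mod k = b mod k" by (metis mod_mult_self2)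
  then have "\<nu> b = \<nu> (a + (b + (k - 1) * a) mod k)" by (simp add: nu_mod) (simp add: nu_eq)
  then show ?thesis using k2 by (intro exI[of _ "(b + (k - 1) * a) mod k"]) auto
qed

lemma nu_add_eq: "u < k \<Longrightarrow> w < k \<Longrightarrow> \<nu> (a + u) = \<nu> (a + w) \<longleftrightarrow> u = w"
proof -
  assume "u < k" "w < k"
  moreover have "(a + u) mod k = (a + w) mod k \<longleftrightarrow> u mod k = w mod k"
    by (simp add: nat_mod_eq_iff add.assoc)
  ultimately show ?thesis by (simp add: nu_eq)
qed

text \<open>One reference process \<open>Q\<close> and one tour of the ring suffice:
  \<open>s ^^ k = id\<close> extends the equation to all \<open>m\<close>, and
  \<open>sem_ren_trans\<close> moves the reference to any other node.\<close>

lemma csymI: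
  assumes "\<And>m. m < k \<Longrightarrow> sem enc (C (\<nu> (a + m))) = sem (enc \<circ> s ^^ m) Q"
  shows "csym C"
  unfolding csym_def
proof (intro allI)
  fix b m
  have *: "sem enc (C (\<nu> (a + m))) = sem (enc \<circ> s ^^ m) Q" for m
    using assms[of "m mod k"] k2 by (simp add: nu_mod s_pow_mod)
  obtain u where u: "\<nu> b = \<nu> (a + u)" using nu_shift by blast
  then have "\<nu> (b + m) = \<nu> (a + (m + u))" 
    using mod_add_cong[of b k "a + u" m m] by (simp add: nu_eq ac_simps)
  moreover have "sem (enc \<circ> s ^^ m) (C (\<nu> b)) = sem (enc \<circ> s ^^ (m + u)) Q"
    using sem_ren_trans[OF *[of u], of "s ^^ m"] by (simp add: u funpow_add)
  ultimately show "sem enc (C (\<nu> (b + m))) = sem (enc \<circ> s ^^ m) (C (\<nu> b))" using * by simp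
qed

text \<open>The restricted names have to be invariant too, so that the images of an action that
  avoids them avoid them again.\<close>

definition symm :: "net \<Rightarrow> bool" where
  "symm S \<longleftrightarrow> finite (fst S) \<and> s ` fst S = fst S \<and> csym (snd S)"

lemma s_pow_image: "s ` R = R \<Longrightarrow> (s ^^ t) x \<in> R \<longleftrightarrow> x \<in> R"
proof (induction t arbitrary: x)
  case (Suc t)
  have "(s ^^ Suc t) x \<in> R \<longleftrightarrow> (s ^^ t) x \<in> R"
    using Suc.prems inj_s by (metis comp_apply funpow.simps(2) inj_image_mem_iff)
  with Suc show ?case by simp
qed simp

definition fresh_orbit :: "name \<Rightarrow> name set \<Rightarrow> bool" where
  "fresh_orbit y F \<longleftrightarrow> (\<forall>t. (s ^^ t) y \<notin> F \<and> ((s ^^ t) y = y \<longrightarrow> t mod k = 0))"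

definition net_names :: "net \<Rightarrow> name set" where
  "net_names S = fst S \<union> (\<Union>v\<in>{1..k}. fnames (snd S v))"

lemma finite_net_names: "finite (fst S) \<Longrightarrow> finite (net_names S)"
  by (simp add: net_names_def finite_fnames)

lemma fresh_orbitD:
  assumes "fresh_orbit y (net_names (R, C))"
  shows "(s ^^ t) y \<notin> R" "v \<in> {1..k} \<Longrightarrow> (s ^^ t) y \<notin> fnames (C v)" "y \<notin> R" "y \<notin> fnames (C (\<nu> a))"
proof -
  have *: "(s ^^ t) y \<notin> net_names (R, C)" for t using assms by (simp add: fresh_orbit_def)
  show "(s ^^ t) y \<notin> R" "v \<in> {1..k} \<Longrightarrow> (s ^^ t) y \<notin> fnames (C v)"
    using *[of t] by (auto simp: net_names_def)
  show "y \<notin> R" "y \<notin> fnames (C (\<nu> a))"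
    using *[of 0] nu_in[of a] by (auto simp: net_names_def)
qed

text \<open>Two different announcements within one round already contradict the existence of a
  leader, so no more about the round is recorded.\<close>

definition emission_spreads :: "(nat \<Rightarrow> nlab) \<Rightarrow> bool" where
  "emission_spreads lb \<longleftrightarrow> (\<forall>t<k. \<forall>n\<in>{1..k}. emits k (lb t) n \<longrightarrow> (\<exists>t'<k. \<exists>n'. n' \<noteq> n \<and> emits k (lb t') n'))"

definition sym_round :: "net \<Rightarrow> bool" where
  "sym_round S \<longleftrightarrow> (\<exists>st lb. st 0 = S \<and> (\<forall>t<k. ntrans k (st t) (lb t) (st (Suc t))) \<and> symm (st k) \<and> emission_spreads lb)"

lemma s_Num_neq: "n \<in> {1..k} \<Longrightarrow> \<exists>n'. s (Num n) = Num n' \<and> n' \<noteq> n"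
proof -
  assume "n \<in> {1..k}"
  then obtain m where m: "\<nu> m = n" using nu_surj by blast
  have "Suc m mod k \<noteq> m mod k" using k2 by (simp add: mod_Suc)
  then have "\<nu> (Suc m) \<noteq> n" using m nu_eq by metis
  with s_Num[of m] m show ?thesis by auto
qed

text \<open>The announcement of one step reappears, moved by \<open>s\<close>, in the next;
  \<open>lb k = lb 0\<close> serves the last step, whose successor is the first step of the
  round.\<close>

lemma emission_spreadsI:
  assumes per: "lb k = lb 0"
    and step: "\<And>t n n'. emits k (lb t) n \<Longrightarrow> s (Num n) = Num n' \<Longrightarrow> emits k (lb (Suc t)) n'"
  shows "emission_spreads lb"
  unfolding emission_spreads_def
proof (intro allI ballI impI)
  fix t n assume t: "t < k" "n \<in> {1..k}" "emits k (lb t) n"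
  obtain n' where n': "s (Num n) = Num n'" "n' \<noteq> n" using s_Num_neq[OF t(2)] by blast
  from step[OF t(3) n'(1)] have "emits k (lb (Suc t)) n'" .
  moreover have "Suc t < k \<or> Suc t = k" using t by auto
  ultimately show "\<exists>t'<k. \<exists>n'. n' \<noteq> n \<and> emits k (lb t') n'" using n' per k2
    by (metis gr0I not_numeral_le_zero)
qed

lemma round_Par:
  assumes S: "symm (R, C)" and tr: "trans (C (\<nu> a)) \<mu> P'" and vis: "act_names \<mu> \<inter> R = {}"
    and fr: "\<And>y. y \<in> act_bn \<mu> \<Longrightarrow> fresh_orbit y (net_names (R, C))"
  shows "sym_round (R, C)"
proof -
  let ?Q = "C (\<nu> a)"
  define lb where "lb t = LPar (\<nu> (a + t)) (ract (s ^^ t) \<mu>)" for t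
  \<comment> \<open>The nodes with \<open>u < t\<close> have moved. The last clause reserves the
    names still to be extruded, as later steps need them fresh for every component.\<close>
  define I where "I t S \<longleftrightarrow> fst S = R \<and>
     (\<forall>u<k. sem enc (snd S (\<nu> (a + u))) = sem (enc \<circ> s ^^ u) (if u < t then P' else ?Q)) \<and>
     (\<forall>t' v y. t \<le> t' \<longrightarrow> t' < k \<longrightarrow> v \<in> {1..k} \<longrightarrow> y \<in> act_bn \<mu> \<longrightarrow> (s ^^ t') y \<notin> fnames (snd S v))" for t and S :: net
  have sR: "s ` R = R" "finite R" "csym C" using S by (auto simp: symm_def)
  have I0: "I 0 (R, C)"
    using fresh_orbitD(2)[OF fr] sR(3) unfolding I_def csym_def by auto
  have "\<exists>S'. ntrans k S (lb t) S' \<and> I (Suc t) S'" if t: "t < k" and I: "I t S" for t S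
  proof -
    obtain D where SD: "S = (R, D)" using I unfolding I_def by (cases S) auto
    have "sem enc (D (\<nu> (a + t))) = sem (enc \<circ> s ^^ t) ?Q" using I t by (auto simp: I_def SD)
    from trans_transfer_ren(2)[OF inj_s_pow this tr] obtain X where
      X: "trans (D (\<nu> (a + t))) (ract (s ^^ t) \<mu>) X" "sem enc X = sem (enc \<circ> s ^^ t) P'" by blast
    have "ntrans k (R, D) (lb t) (R, D(\<nu> (a + t) := X))"
      unfolding lb_def
    proof (rule n_Par[of "\<nu> (a + t)" k D "ract (s ^^ t) \<mu>" X R, OF nu_in X(1)])
      show "act_names (ract (s ^^ t) \<mu>) \<inter> R = {}" using vis s_pow_image[OF sR(1)] by auto
      show "\<forall>j\<in>{1..k} - {\<nu> (a + t)}. act_bn (ract (s ^^ t) \<mu>) \<inter> fnames (D j) = {}"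
        using I t by (auto simp: I_def SD)
    qed
    moreover have "I (Suc t) (R, D(\<nu> (a + t) := X))"
    proof -
      have "sem enc ((D(\<nu> (a + t) := X)) (\<nu> (a + u))) = sem (enc \<circ> s ^^ u) (if u < Suc t then P' else ?Q)" if "u < k" for u
      proof (cases "u = t")
        case True
        then show ?thesis using X by simp
      next
        case False
        then have "\<nu> (a + u) \<noteq> \<nu> (a + t)" using that t by (simp add: nu_add_eq)
        then show ?thesis using I that False by (auto simp: I_def SD less_Suc_eq)
      qed
      moreover have "(s ^^ t') y \<notin> fnames ((D(\<nu> (a + t) := X)) v)"
        if "Suc t \<le> t'" "t' < k" "v \<in> {1..k}" "y \<in> act_bn \<mu>" for t' v y
      proof -
        \<comment> \<open>The only new name in \<open>X\<close> is the one extruded in this step,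
          and the members of the orbit met within one round are distinct.\<close>
        from that(4) obtain x where mu: "\<mu> = BOutA x y" by (cases \<mu>) auto
        have "(s ^^ t) x \<in> fnames (D (\<nu> (a + t)))" using trans_fnames[OF X(1)] by (simp add: mu)
        then have "fnames X \<subseteq> insert ((s ^^ t) y) (fnames (D (\<nu> (a + t))))"
          using fnames_trans[OF X(1)] by (auto simp: mu)
        moreover have "(s ^^ t') y \<noteq> (s ^^ t) y"
          using s_pow_eq[of y t' t] fr[OF that(4)] that t by (auto simp: fresh_orbit_def)
        ultimately show ?thesis using I that nu_in[of "a + t"] by (auto simp: I_def SD)
      qed
      ultimately show ?thesis by (auto simp: I_def)
    qed
    ultimately show ?thesis unfolding SD by blast
  qed
  from chain_steps[of I "(R, C)" k "\<lambda>t S S'. ntrans k S (lb t) S'", OF I0 this]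
  obtain st where st: "st 0 = (R, C)" "\<forall>t<k. ntrans k (st t) (lb t) (st (Suc t))" "I k (st k)" by blast
  have "symm (st k)"
    using st(3) sR csymI[of "snd (st k)" a P'] by (auto simp: symm_def I_def)
  moreover have "emission_spreads lb"
  proof (rule emission_spreadsI)
    show "lb k = lb 0" by (simp add: lb_def s_pow) (simp add: nu_eq)
    fix t n n' assume "emits k (lb t) n" and n': "s (Num n) = Num n'"
    then have "ract (s ^^ t) \<mu> = OutA Obs (Num n)" by (auto simp: emits_def lb_def split: if_splits)
    then have "ract (s ^^ Suc t) \<mu> = OutA Obs (Num n')" using s_Obs n' ract_ract[of s "s ^^ t" \<mu>] by simp
    then show "emits k (lb (Suc t)) n'" using nu_in[of "a + Suc t"] by (auto simp: emits_def lb_def simp del: funpow.simps)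
  qed
  ultimately show ?thesis using st unfolding sym_round_def by blast
qed

text \<open>\<open>bd\<close> marks Close as opposed to Com, so that both share one invariant;
  \<open>r\<close> is the distance from sender to receiver along the ring, which is the same for all
  images of the step.\<close>

lemma round_Comm:
  assumes S: "symm (R, C)" and r: "0 < r" "r < k"
    and tro: "trans (C (\<nu> a)) \<alpha> P1" and tri: "trans (C (\<nu> (a + r))) (InA x y) P2"
    and al: "\<alpha> = (if bd then BOutA x y else OutA x y)"
    and fr: "bd \<Longrightarrow> fresh_orbit y (net_names (R, C))"
  shows "sym_round (R, C)"
proof -
  let ?Q = "C (\<nu> a)"
  have sR: "s ` R = R" "finite R" "csym C" using S by (auto simp: symm_def)
  have inv_r: "(s ^^ r) ((s ^^ (k - r)) z) = z" for z
    using r s_pow by (metis comp_apply funpow_add id_apply le_add_diff_inverse less_imp_le)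
  \<comment> \<open>The input is pulled back from the receiver to the sender \<open>\<nu> a\<close>,
    where it meets the output; \<open>s ^^ (k - r)\<close> inverts \<open>s ^^ r\<close>.\<close>
  define x0 where "x0 = (s ^^ (k - r)) x"
  define y0 where "y0 = (s ^^ (k - r)) y"
  have in0: "InA x y = ract (s ^^ r) (InA x0 y0)" by (simp add: x0_def y0_def inv_r)
  have "sem enc (C (\<nu> (a + r))) = sem (enc \<circ> s ^^ r) ?Q" using sR(3) by (simp add: csym_def)
  from trans_transfer_ren(1)[OF inj_s_pow this tri[unfolded in0]] obtain P2' where
    tri': "trans ?Q (InA x0 y0) P2'" by blast
  \<comment> \<open>For a bound output, \<open>x0\<close> is free in the process and
    \<open>y\<close> is not, while \<open>y0\<close> differs from \<open>y\<close> because the orbit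
    of \<open>y\<close> has length \<open>k\<close> and \<open>0 < r < k\<close>: no node receives
    the name that it extrudes itself.\<close>
  have "\<alpha> = OutA x y \<or> \<alpha> = BOutA x y \<and> y \<noteq> x0 \<and> y \<noteq> y0"
  proof (cases bd)
    case True
    have "x0 \<in> fnames ?Q"
      using trans_fnames[OF tri'] by simp
    moreover have "y \<notin> fnames ?Q" using fresh_orbitD(4)[OF fr[OF True]] .
    moreover have "(k - r) mod k \<noteq> 0" using r by simp
    then have "y0 \<noteq> y" using fr[OF True] by (auto simp: fresh_orbit_def y0_def)
    ultimately show ?thesis using al True by auto
  qed (simp add: al)
  from trans_out_in_diamond[OF this tro tri'] obtain F1 F2 where
    F: "trans P1 (InA x0 y0) F1" "trans P2' \<alpha> F2" "sem enc F1 = sem enc F2" by blast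
  \<comment> \<open>The state of a node depends only on whether it has sent (\<open>d\<close>) and
    received (\<open>i\<close>). After both, \<open>F1\<close> stands for either order, so the step
    from \<open>P2'\<close> reaches it only up to congruence.\<close>
  define stt where "stt d i = (if d then if i then F1 else P1 else if i then P2' else ?Q)" for d i
  have stt_out: "\<exists>X. trans (stt False i) \<alpha> X \<and> (\<forall>f. sem f X = sem f (stt True i))" for i
    using tro F sem_eq_any_env[OF inj_enc F(3)[symmetric]] by (auto simp: stt_def)
  have stt_in: "trans (stt d False) (InA x0 y0) (stt d True)" for d
    using tri' F by (auto simp: stt_def)
  \<comment> \<open>Counting nodes from \<open>\<nu> a\<close>, node \<open>u\<close> sends in step \<open>u\<close> and receives in step \<open>p u\<close>.\<close>
  define p where "p u = (if r \<le> u then u - r else u + k - r)" for u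
  define lb where "lb t = (if bd then LClose else LCom) (\<nu> (a + t)) (\<nu> (a + r + t)) ((s ^^ t) x) ((s ^^ t) y)" for t
  define rs where "rs t = R \<union> (if bd then (\<lambda>u. (s ^^ u) y) ` {..<t} else {})" for t :: nat
  define I where "I t S \<longleftrightarrow> fst S = rs t \<and>
     (\<forall>u<k. sem enc (snd S (\<nu> (a + u))) = sem (enc \<circ> s ^^ u) (stt (u < t) (p u < t))) \<and>
     (bd \<longrightarrow> (\<forall>t' v. t \<le> t' \<longrightarrow> t' < k \<longrightarrow> v \<in> {1..k} \<longrightarrow> (s ^^ t') y \<notin> fnames (snd S v)))" for t and S :: net
  have I0: "I 0 (R, C)"
    using fresh_orbitD(2)[OF fr] sR(3) unfolding I_def csym_def by (auto simp: rs_def stt_def)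
  have "\<exists>S'. ntrans k S (lb t) S' \<and> I (Suc t) S'" if t: "t < k" and I: "I t S" for t S
  proof -
    \<comment> \<open>The receiver of step \<open>t\<close>, counted from \<open>\<nu> a\<close>:
      \<open>r + t\<close> modulo \<open>k\<close>.\<close>
    define w where "w = (if r + t < k then r + t else r + t - k)"
    have w: "w < k" "w \<noteq> t" "p w = t" "p t \<noteq> t" using r t by (auto simp: w_def p_def)
    have pw: "u < k \<Longrightarrow> p u = t \<longleftrightarrow> u = w" for u using r t by (auto simp: w_def p_def)
    have wm: "w = (r + t) mod k" using r t by (auto simp: w_def mod_if)
    have nuw: "\<nu> (a + w) = \<nu> (a + r + t)" by (simp add: wm nu_mod add.assoc)
    have ract_w: "ract (s ^^ w) (InA x0 y0) = InA ((s ^^ t) x) ((s ^^ t) y)"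
    proof -
      have "s ^^ w = s ^^ t \<circ> s ^^ r" by (simp add: wm s_pow_mod add.commute[of r] funpow_add)
      then show ?thesis by (simp add: x0_def y0_def inv_r)
    qed
    obtain D where SD: "S = (rs t, D)" using I unfolding I_def by (cases S) auto
    have Dt: "sem enc (D (\<nu> (a + u))) = sem (enc \<circ> s ^^ u) (stt (u < t) (p u < t))" if "u < k" for u
      using I that by (auto simp: I_def SD)
    from stt_out[of "p t < t"] obtain X0 where X0: "trans (stt False (p t < t)) \<alpha> X0"
      "\<And>f. sem f X0 = sem f (stt True (p t < t))" by blast
    have "sem enc (D (\<nu> (a + t))) = sem (enc \<circ> s ^^ t) (stt False (p t < t))" using Dt[OF t] by simp
    from trans_transfer_ren(2)[OF inj_s_pow this X0(1)] obtain X where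
      X: "trans (D (\<nu> (a + t))) (ract (s ^^ t) \<alpha>) X" "sem enc X = sem (enc \<circ> s ^^ t) (stt True (p t < t))"
      using X0(2) by auto
    have "sem enc (D (\<nu> (a + w))) = sem (enc \<circ> s ^^ w) (stt (w < t) False)" using Dt[OF w(1)] w by simp
    from trans_transfer_ren(2)[OF inj_s_pow this stt_in] obtain Y where
      Y: "trans (D (\<nu> (a + w))) (InA ((s ^^ t) x) ((s ^^ t) y)) Y" "sem enc Y = sem (enc \<circ> s ^^ w) (stt (w < t) True)"
      unfolding ract_w by blast
    let ?D = "D(\<nu> (a + t) := X, \<nu> (a + w) := Y)"
    have ne: "\<nu> (a + t) \<noteq> \<nu> (a + w)" using nu_add_eq[OF t w(1)] w by auto
    have yorb: "(s ^^ t') y \<noteq> (s ^^ t) y" if "bd" "t' < k" "t' \<noteq> t" for t'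
      using s_pow_eq[of y t' t] fr that t by (auto simp: fresh_orbit_def)
    have yR: "(s ^^ t) y \<notin> rs t" if bd
    proof -
      have "(s ^^ t) y \<noteq> (s ^^ u) y" if "u < t" for u using yorb[OF \<open>bd\<close>, of u] that t by auto
      then show ?thesis using fresh_orbitD(1)[OF fr[OF \<open>bd\<close>]] by (auto simp: rs_def)
    qed
    have "ntrans k (rs t, D) (lb t) (rs (Suc t), ?D)"
    proof (cases bd)
      case True
      have "rs (Suc t) = insert ((s ^^ t) y) (rs t)" using True by (auto simp: rs_def lessThan_Suc)
      moreover have "\<forall>l\<in>{1..k} - {\<nu> (a + t)}. (s ^^ t) y \<notin> fnames (D l)" using I True t by (auto simp: I_def SD)
      ultimately show ?thesis
        using n_Close[of "\<nu> (a + t)" k "\<nu> (a + w)" D "(s ^^ t) x" "(s ^^ t) y" X Y "rs t"]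
          nu_in ne X(1) Y(1) yR[OF True] True
        by (simp add: lb_def nuw al)
    next
      case False
      then have "rs (Suc t) = rs t" by (simp add: rs_def)
      then show ?thesis using n_Com[of "\<nu> (a + t)" k "\<nu> (a + w)" D "(s ^^ t) x" "(s ^^ t) y" X Y "rs t"]
          nu_in ne X(1) Y(1) False
        by (simp add: lb_def nuw al)
    qed
    moreover have "I (Suc t) (rs (Suc t), ?D)"
    proof -
      have "sem enc (?D (\<nu> (a + u))) = sem (enc \<circ> s ^^ u) (stt (u < Suc t) (p u < Suc t))" if "u < k" for u
      proof -
        consider "u = t" | "u = w" | "u \<noteq> t" "u \<noteq> w" by blast
        then show ?thesis
        proof cases
          case 1
          then show ?thesis using X w ne by (auto simp: less_Suc_eq)
        next
          case 2
          then show ?thesis using Y w by (auto simp: less_Suc_eq)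
        next
          case 3
          then show ?thesis using Dt[OF that] pw[OF that] nu_add_eq[OF that t] nu_add_eq[OF that w(1)]
            by (auto simp: less_Suc_eq)
        qed
      qed
      moreover have "(s ^^ t') y \<notin> fnames (?D v)" if "bd" "Suc t \<le> t'" "t' < k" "v \<in> {1..k}" for t' v
      proof -
        have D': "(s ^^ t') y \<notin> fnames (D v)" if "v \<in> {1..k}" for v
          using I \<open>bd\<close> \<open>Suc t \<le> t'\<close> \<open>t' < k\<close> that by (auto simp: I_def SD)
        have "fnames X \<subseteq> insert ((s ^^ t) y) (fnames (D (\<nu> (a + t))))"
          using fnames_trans[OF X(1)] trans_fnames[OF X(1)] \<open>bd\<close> by (auto simp: al)
        moreover have "fnames Y \<subseteq> insert ((s ^^ t) y) (fnames (D (\<nu> (a + w))))"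
          using fnames_trans[OF Y(1)] trans_fnames[OF Y(1)] by auto
        moreover have "(s ^^ t') y \<noteq> (s ^^ t) y" using yorb that by auto
        ultimately show ?thesis using D' that(4) nu_in by auto
      qed
      ultimately show ?thesis by (auto simp: I_def)
    qed
    ultimately show ?thesis unfolding SD by blast
  qed
  from chain_steps[of I "(R, C)" k "\<lambda>t S S'. ntrans k S (lb t) S'", OF I0 this]
  obtain st where st: "st 0 = (R, C)" "\<forall>t<k. ntrans k (st t) (lb t) (st (Suc t))" "I k (st k)" by blast
  \<comment> \<open>During a round the restricted names contain only part of the orbit of
    \<open>y\<close>; after \<open>k\<close> steps the orbit is complete and the set is invariant
    again.\<close>
  have "s ` ((\<lambda>u. (s ^^ u) y) ` {..<k}) = (\<lambda>u. (s ^^ u) y) ` {..<k}"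
  proof -
    have "(s ^^ u) y \<in> (\<lambda>u. (s ^^ u) y) ` {..<k}" for u
      using k2 by (intro image_eqI[of _ _ "u mod k"]) (auto simp: s_pow_mod)
    from this[of "Suc _"] have "s ` ((\<lambda>u. (s ^^ u) y) ` {..<k}) \<subseteq> (\<lambda>u. (s ^^ u) y) ` {..<k}"
      unfolding image_image by (intro image_subsetI) simp
    then show ?thesis by (rule endo_inj_surj[rotated]) (auto intro: inj_on_subset[OF inj_s])
  qed
  then have "s ` rs k = rs k" using sR by (simp add: rs_def image_Un)
  moreover have "finite (rs k)" using sR by (simp add: rs_def)
  moreover have "csym (snd (st k))"
  proof (rule csymI)
    fix m assume "m < k"
    then have "p m < k" using r by (auto simp: p_def)
    with st(3) \<open>m < k\<close> show "sem enc (snd (st k) (\<nu> (a + m))) = sem (enc \<circ> s ^^ m) F1"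
      by (auto simp: I_def stt_def)
  qed
  ultimately have "symm (st k)"
    using st(3) by (simp add: symm_def I_def)
  moreover have "emission_spreads lb"
  proof (rule emission_spreadsI)
    show "lb k = lb 0" using nu_eq[of "a + k" a] nu_eq[of "a + r + k" "a + r"] by (simp add: lb_def s_pow)
    fix t n n' assume "emits k (lb t) n" and n': "s (Num n) = Num n'"
    then have "\<not> bd" "(s ^^ t) x = Obs" "(s ^^ t) y = Num n"
      by (auto simp: emits_def lb_def split: if_splits)
    then show "emits k (lb (Suc t)) n'" using nu_in[of "a + Suc t"] n' s_Obs
      by (auto simp: emits_def lb_def intro!: bexI[of _ "\<nu> (Suc (a + t))"])
  qed
  ultimately show ?thesis using st unfolding sym_round_def by blast
qed

lemma round_exists:
  assumes "symm S" "ntrans k S l S'"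
  shows "sym_round S"
  using assms(2)
proof cases
  case (n_Par i C \<mu> P' R)
  obtain a where a: "i = \<nu> a" using nu_surj n_Par by metis
  have fin: "finite (net_names (R, C))" using assms(1) n_Par finite_net_names by (auto simp: symm_def)
  show ?thesis
  proof (cases "\<exists>x y. \<mu> = BOutA x y")
    case True
    then obtain x y where mu: "\<mu> = BOutA x y" by blast
    from fresh_cycle[OF fin] obtain z where z: "fresh_orbit z (net_names (R, C))" unfolding fresh_orbit_def by blast
    then have zz: "z \<notin> fnames (C (\<nu> a))" "z \<notin> R" by (rule fresh_orbitD)+
    from trans_bout_rename[OF _ zz(1)] n_Par a mu obtain P'' where "trans (C (\<nu> a)) (BOutA x z) P''" by blast
    with round_Par[of R C a "BOutA x z" P''] z zz n_Par assms(1) mu show ?thesis by auto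
  next
    case False
    then have "act_bn \<mu> = {}" by (cases \<mu>) auto
    with round_Par[of R C a \<mu> P'] n_Par assms(1) a show ?thesis by auto
  qed
next
  case (n_Com i j C x y Pi Pj R)
  obtain a where a: "i = \<nu> a" using nu_surj n_Com by metis
  obtain b where b: "j = \<nu> b" using nu_surj n_Com by metis
  obtain r where r: "r < k" "j = \<nu> (a + r)" using nu_shift[of b a] b by auto
  have "0 < r" using r a n_Com by (cases r) auto
  from round_Comm[OF _ this r(1), of R C a "OutA x y" Pi x y Pj False] n_Com a r assms(1) show ?thesis by simp
next
  case (n_Close i j C x y Pi Pj R)
  obtain a where a: "i = \<nu> a" using nu_surj n_Close by metis
  obtain b where b: "j = \<nu> b" using nu_surj n_Close by metis
  obtain r where r: "r < k" "j = \<nu> (a + r)" using nu_shift[of b a] b by auto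
  have r0: "0 < r" using r a n_Close by (cases r) auto
  have fin: "finite (net_names (R, C))" using assms(1) n_Close finite_net_names by (auto simp: symm_def)
  from fresh_cycle[OF fin] obtain z where z: "fresh_orbit z (net_names (R, C))" unfolding fresh_orbit_def by blast
  then have zz: "z \<notin> fnames (C (\<nu> a))" by (rule fresh_orbitD)
  from trans_bout_rename[OF _ zz] n_Close a obtain P1 where P1: "trans (C (\<nu> a)) (BOutA x z) P1" by blast
  from trans_in_rename n_Close r obtain P2 where P2: "trans (C (\<nu> (a + r))) (InA x z) P2" by blast
  with round_Comm[of R C r a "BOutA x z" P1 x z P2 True] r0 r(1) P1 n_Close z assms(1) show ?thesis by simp
qed

end

section \<open>The infinite symmetric computation\<close>

lemma emits_comp_contains:
  "emits k (labs C m) n \<Longrightarrow> enat m < len C \<Longrightarrow> comp_contains k C (OutA Obs (Num n))"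
proof -
  assume "emits k (labs C m) n" "enat m < len C"
  then obtain i where "i \<in> {1..k}" "proj C i m = Some (snd (states C m) i, OutA Obs (Num n), snd (states C (Suc m)) i)"
    by (auto simp: emits_def proj_def)
  then show ?thesis unfolding comp_contains_def proj_contains_def by blast
qed

lemma proj_contains_emits:
  assumes "proj_contains C i (OutA Obs (Num n))" "i \<in> {1..k}"
  shows "\<exists>m. enat m < len C \<and> emits k (labs C m) n"
proof -
  from assms(1) obtain m where "enat m < len C" "contrib i (labs C m) = Some (OutA Obs (Num n))"
    unfolding proj_contains_def proj_def by (auto split: if_splits option.splits)
  with assms(2) show ?thesis unfolding emits_def by blast
qed

lemma extends_refl: "extends C C"
  by (simp add: extends_def)

context ring_symmetry
begin

definition silent :: "comp \<Rightarrow> bool" where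
  "silent C \<longleftrightarrow> (\<forall>m n. enat m < len C \<longrightarrow> n \<in> {1..k} \<longrightarrow> \<not> emits k (labs C m) n)"

definition sym_comp :: "(nat \<Rightarrow> proc) \<Rightarrow> nat \<Rightarrow> comp \<Rightarrow> bool" where
  "sym_comp P h C \<longleftrightarrow> is_comp k (init_net P) C \<and> len C = enat (k * h) \<and> symm (states C (k * h)) \<and> silent C"

text \<open>The electoral property is used twice: a silent computation must have a further step,
  from which a round is obtained, and no computation may contain the two announcements that a
  non-silent round would make.\<close>

lemma sym_comp_extend:
  assumes E: "electoral k P" and G: "sym_comp P h C"
  shows "\<exists>C'. sym_comp P (Suc h) C' \<and> extends C C'"
proof -
  let ?n = "k * h"
  have G': "is_comp k (init_net P) C" "len C = enat ?n" "symm (states C ?n)" "silent C"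
    using G by (auto simp: sym_comp_def)
  from E G'(1) obtain C1 n where C1: "is_comp k (init_net P) C1" "extends C C1" "n \<in> {1..k}"
    "\<forall>i\<in>{1..k}. proj_contains C1 i (OutA Obs (Num n))" unfolding electoral_def by blast
  have "1 \<in> {1..k}" using k2 by simp
  with C1(4) obtain m where m: "enat m < len C1" "emits k (labs C1 m) n" using proj_contains_emits by blast
  \<comment> \<open>\<open>C\<close> is silent, so the announcement lies beyond it and
    \<open>C1\<close> is strictly longer.\<close>
  have "\<not> m < ?n"
  proof
    assume "m < ?n"
    then have "emits k (labs C m) n" using m C1(2) G'(2) by (simp add: extends_def)
    with \<open>m < ?n\<close> G' C1(3) show False by (simp add: silent_def)
  qed
  then have "enat ?n < len C1" using m(1) by (metis enat_ord_simps(1) not_less order_le_less_trans)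
  then have "ntrans k (states C1 ?n) (labs C1 ?n) (states C1 (Suc ?n))" using C1(1) by (simp add: is_comp_def)
  moreover have "states C1 ?n = states C ?n" using C1(2) G'(2) by (simp add: extends_def)
  ultimately have "sym_round (states C ?n)" using round_exists[OF G'(3)] by simp
  then obtain st lb where st: "st 0 = states C ?n" "\<forall>t<k. ntrans k (st t) (lb t) (st (Suc t))" "symm (st k)"
    "emission_spreads lb" unfolding sym_round_def by blast
  define C2 where "C2 = Comp (\<lambda>m. if m \<le> ?n then states C m else st (m - ?n))
     (\<lambda>m. if m < ?n then labs C m else lb (m - ?n)) (enat (?n + k))"
  have S2: "states C2 (?n + t) = st t" for t using st(1) by (simp add: C2_def)
  have comp: "is_comp k (init_net P) C2"
    unfolding is_comp_def
  proof (intro conjI allI impI)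
    show "states C2 0 = init_net P" using G'(1) by (simp add: C2_def is_comp_def)
    fix m assume "enat m < len C2"
    then have m: "m < ?n + k" by (simp add: C2_def)
    show "ntrans k (states C2 m) (labs C2 m) (states C2 (Suc m))"
    proof (cases "m < ?n")
      case True
      then show ?thesis using G'(1,2) by (simp add: C2_def is_comp_def)
    next
      case False
      define t where "t = m - ?n"
      have t: "m = ?n + t" "t < k" using False m by (auto simp: t_def)
      have "labs C2 m = lb t" by (simp add: C2_def t)
      then show ?thesis using S2[of t] S2[of "Suc t"] st(2) t by simp
    qed
  qed
  have ext: "extends C C2" by (auto simp: extends_def C2_def G'(2))
  have "silent C2"
    unfolding silent_def
  proof (intro allI impI notI)
    fix m n assume m: "enat m < len C2" "n \<in> {1..k}" "emits k (labs C2 m) n"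
    then have mk: "m < ?n + k" by (simp add: C2_def)
    have "\<not> m < ?n" using m G'(4,2) by (auto simp: silent_def C2_def)
    then have "emits k (lb (m - ?n)) n" "m - ?n < k" using m(3) mk by (auto simp: C2_def)
    with st(4) m(2) obtain t' n' where n': "t' < k" "n' \<noteq> n" "emits k (lb t') n'" unfolding emission_spreads_def by blast
    then have "emits k (labs C2 (?n + t')) n'" "enat (?n + t') < len C2" by (auto simp: C2_def)
    with m have two: "\<exists>m. enat m < len C2 \<and> emits k (labs C2 m) n" "\<exists>m. enat m < len C2 \<and> emits k (labs C2 m) n'"
      by blast+
    \<comment> \<open>Every announcement in \<open>C2\<close> persists in the extension
      \<open>C3\<close>, where only \<open>n3\<close> may be announced.\<close>
    from E comp obtain C3 n3 where C3: "is_comp k (init_net P) C3" "extends C2 C3"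
      "\<forall>C''. is_comp k (init_net P) C'' \<and> extends C3 C'' \<longrightarrow> (\<forall>m. m \<noteq> n3 \<longrightarrow> \<not> comp_contains k C'' (OutA Obs (Num m)))"
      unfolding electoral_def by blast
    have "j = n3" if "\<exists>m. enat m < len C2 \<and> emits k (labs C2 m) j" for j
    proof -
      from that obtain m where m: "enat m < len C2" "emits k (labs C2 m) j" by blast
      then have "enat m < len C3" "labs C3 m = labs C2 m" using C3(2) by (auto simp: extends_def)
      with m have "comp_contains k C3 (OutA Obs (Num j))" using emits_comp_contains by metis
      with C3(1,3) extends_refl show ?thesis by blast
    qed
    from this[OF two(1)] this[OF two(2)] n'(2) show False by simp
  qed
  moreover have "symm (states C2 (k * Suc h))" using S2[of k] st(3) by (simp add: add.commute)
  moreover have "len C2 = enat (k * Suc h)" by (simp add: C2_def add.commute)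
  ultimately show ?thesis using comp ext unfolding sym_comp_def by blast
qed

theorem not_electoral:
  assumes "csym P"
  shows "\<not> electoral k P"
proof
  assume E: "electoral k P"
  have "sym_comp P 0 (Comp (\<lambda>_. init_net P) (\<lambda>_. undefined) 0)"
    using assms by (simp add: sym_comp_def is_comp_def symm_def init_net_def silent_def zero_enat_def)
  then obtain Cs where Cs: "\<And>h. sym_comp P h (Cs h)" "\<And>h. extends (Cs h) (Cs (Suc h))"
    using dependent_nat_choice[of "sym_comp P" "\<lambda>_. extends"] sym_comp_extend[OF E] by metis
  \<comment> \<open>State \<open>m\<close> is settled after \<open>m\<close> rounds because
    \<open>m \<le> k * m\<close>; label \<open>m\<close> requires more than \<open>m\<close> steps,
    hence \<open>Suc m\<close>.\<close>
  define C where "C = Comp (\<lambda>m. states (Cs m) m) (\<lambda>m. labs (Cs (Suc m)) m) \<infinity>"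
  have len: "len (Cs h) = enat (k * h)" for h using Cs(1)[of h] by (simp add: sym_comp_def)
  have mk: "m \<le> k * m" "m < k * Suc m" for m using k2 by (cases k; simp)+
  have "is_comp k (init_net P) C"
    unfolding is_comp_def
  proof (intro conjI allI impI)
    show "states C 0 = init_net P" using Cs(1)[of 0] by (simp add: C_def sym_comp_def is_comp_def)
    fix m
    have "states (Cs (Suc m)) m = states (Cs m) m"
      using Cs(2)[of m] mk[of m] by (simp add: extends_def len)
    moreover have "ntrans k (states (Cs (Suc m)) m) (labs (Cs (Suc m)) m) (states (Cs (Suc m)) (Suc m))"
      using Cs(1)[of "Suc m"] mk(2)[of m] by (simp add: sym_comp_def is_comp_def)
    ultimately show "ntrans k (states C m) (labs C m) (states C (Suc m))" by (simp add: C_def)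
  qed
  \<comment> \<open>An extension of an infinite computation has the same labels, so the leader would
    already be announced in \<open>C\<close>.\<close>
  with E obtain C' n where C': "extends C C'" "n \<in> {1..k}" "\<forall>i\<in>{1..k}. proj_contains C' i (OutA Obs (Num n))"
    unfolding electoral_def by blast
  have "1 \<in> {1..k}" using k2 by simp
  with C'(3) obtain m where "emits k (labs C' m) n" using proj_contains_emits by blast
  then have "emits k (labs (Cs (Suc m)) m) n" using C'(1) by (simp add: extends_def C_def)
  moreover have "enat m < len (Cs (Suc m))" using mk(2)[of m] by (simp add: len)
  ultimately show False using Cs(1)[of "Suc m"] C'(2) by (auto simp: sym_comp_def silent_def)
qed

end

section \<open>From the hypergraph automorphism to the ring symmetry\<close>

text \<open>The first return time \<open>d\<close> of \<open>a\<close> is the size of its orbit,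
  which is all of \<open>A\<close>.\<close>

lemma single_orbit_period:
  assumes p: "\<sigma> permutes A" and fin: "finite A" and orb: "node_orbit \<sigma> a = A"
  shows "(\<sigma> ^^ m) a = (\<sigma> ^^ m') a \<longleftrightarrow> m mod card A = m' mod card A"
proof -
  have perm: "permutation \<sigma>" using p fin permutation_permutes by blast
  have self: "a \<in> orbit \<sigma> a" using perm by (rule permutation_self_in_orbit)
  have "orbit \<sigma> a = A" using orb orbit_altdef_permutation[OF perm, of a] by (simp add: node_orbit_def)
  moreover define d where "d = funpow_dist1 \<sigma> a a"
  moreover have inj: "inj_on (\<lambda>n. (\<sigma> ^^ n) a) {0..<d}"
    unfolding d_def by (rule inj_on_funpow_dist1[OF self])
  ultimately have "d = card A" using orbit_conv_funpow_dist1[OF self] by (metis card_atLeastLessThan card_image diff_zero)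
  have per: "(\<sigma> ^^ d) a = a" unfolding d_def by (rule funpow_dist1_prop[OF self])
  have "d > 0" by (simp add: d_def)
  have "(\<sigma> ^^ m) a = (\<sigma> ^^ (m mod d)) a" for m using funpow_mod_eq[OF per] by metis
  then have "(\<sigma> ^^ m) a = (\<sigma> ^^ m') a \<longleftrightarrow> (\<sigma> ^^ (m mod d)) a = (\<sigma> ^^ (m' mod d)) a" by metis
  also have "\<dots> \<longleftrightarrow> m mod d = m' mod d" using inj \<open>d > 0\<close> by (auto simp: inj_on_def)
  finally show ?thesis by (simp add: \<open>d = card A\<close>)
qed

text \<open>Provides whole orbits of length \<open>k\<close> consisting of names that no process uses yet.\<close>

definition block_rotation :: "nat \<Rightarrow> nat \<Rightarrow> (name \<Rightarrow> name) \<Rightarrow> name \<Rightarrow> name" where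
  "block_rotation N k f x = (case x of
     Nm n \<Rightarrow> if N \<le> n then Nm (N + k * ((n - N) div k) + Suc ((n - N) mod k) mod k) else f x
   | _ \<Rightarrow> f x)"

lemma block_rotation_pow:
  assumes "0 < k"
  shows "(block_rotation N k f ^^ t) (Nm (N + k * q + j mod k)) = Nm (N + k * q + (j + t) mod k)"
proof (induction t)
  case (Suc t)
  have "(block_rotation N k f ^^ Suc t) (Nm (N + k * q + j mod k)) = block_rotation N k f (Nm (N + (k * q + (j + t) mod k)))"
    using Suc by (simp add: add.assoc)
  also have "\<dots> = Nm (N + k * q + Suc (j + t) mod k)"
    using assms by (simp add: block_rotation_def mod_Suc_eq)
  finally show ?case by simp
qed simp

lemma funpow_fix: "f x = x \<Longrightarrow> (f ^^ t) x = x"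
  by (induction t) auto

theorem mainTheorem2:
  fixes k :: nat and P :: "nat \<Rightarrow> proc"
    and \<sigma>N :: "nat \<Rightarrow> nat" and \<sigma>X :: "name \<Rightarrow> name"
  assumes "hg_automorphism k P \<sigma>N \<sigma>X"
    and "(\<sigma>N, \<sigma>X) \<noteq> (id, id)"
    and "\<forall>i\<in>{1..k}. node_orbit \<sigma>N i = {1..k}"
    and "symmetric_wrt k P \<sigma>N \<sigma>X"
  shows "\<not> electoral k P"
proof -
  define s0 where "s0 = sig_name k P \<sigma>N \<sigma>X"
  define A where "A = (\<Union>i\<in>{1..k}. fnames (P i))"
  have permN: "\<sigma>N permutes {1..k}" and permX: "\<sigma>X permutes hg_arcs k P"
    using assms(1) by (auto simp: hg_automorphism_def)
  have arcs: "hg_arcs k P = A - {Obs}" by (simp add: hg_arcs_def A_def)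
  have s0_Obs: "s0 Obs = Obs" and s0_Num: "n \<in> {1..k} \<Longrightarrow> s0 (Num n) = Num (\<sigma>N n)" for n
    by (auto simp: s0_def sig_name_def arcs)
  have s0_other: "s0 x = x" if "x \<notin> A" "x \<notin> Num ` {1..k}" for x
    using that by (auto simp: s0_def sig_name_def arcs split: name.split)
  \<comment> \<open>Without nodes there are no arcs, and both permutations would be
    identities.\<close>
  have k0: "k \<noteq> 0"
  proof
    assume "k = 0"
    then have "\<sigma>N = id" "\<sigma>X = id" using permN permX by (auto simp: hg_arcs_def permutes_empty)
    with assms(2) show False by simp
  qed
  define \<nu> where "\<nu> m = (\<sigma>N ^^ m) 1" for m
  have orb1: "node_orbit \<sigma>N 1 = {1..k}" using assms(3) k0 by auto
  have nu_eq: "\<nu> m = \<nu> m' \<longleftrightarrow> m mod k = m' mod k" for m m'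
    using single_orbit_period[OF permN _ orb1] by (simp add: \<nu>_def)
  have nu_in: "\<nu> m \<in> {1..k}" for m using orb1 by (auto simp: node_orbit_def \<nu>_def)
  have nu_surj: "\<exists>m. \<nu> m = i" if "i \<in> {1..k}" for i
    using that unfolding orb1[symmetric] by (auto simp: node_orbit_def \<nu>_def)
  have sigma_k: "(\<sigma>N ^^ k) i = i" if i: "i \<in> {1..k}" for i
  proof -
    obtain m where m: "\<nu> m = i" using nu_surj[OF i] by blast
    have "(\<sigma>N ^^ k) i = \<nu> (k + m)" by (simp add: m[symmetric] \<nu>_def funpow_add)
    with nu_eq[of "k + m" m] m show ?thesis by simp
  qed
  have db_step: "db e (P (\<sigma>N i)) = db (e \<circ> s0) (P i)" if "i \<in> {1..k}" for e i
  proof -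
    have "alpha (P (\<sigma>N i)) (ren s0 (P i))"
      using assms(4) that by (simp add: symmetric_wrt_def sig_proc_def s0_def)
    from db_alpha[OF this] show ?thesis by (simp add: db_ren)
  qed
  have sigma_in: "(\<sigma>N ^^ m) i \<in> {1..k}" if "i \<in> {1..k}" for i m
    using that permutes_in_image[OF permN] by (induction m) auto
  have db_pow: "db e (P ((\<sigma>N ^^ m) i)) = db (e \<circ> s0 ^^ m) (P i)" if i: "i \<in> {1..k}" for e i m
  proof (induction m arbitrary: e)
    case (Suc m)
    have "db e (P ((\<sigma>N ^^ Suc m) i)) = db (e \<circ> s0) (P ((\<sigma>N ^^ m) i))" using db_step[OF sigma_in[OF i]] by simp
    then show ?case by (simp add: Suc comp_assoc)
  qed simp
  \<comment> \<open>\<^const>\<open>sig_name\<close> need not be injective, since \<open>\<sigma>X\<close> may map other arcs to node identifiers. But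
    \<open>P i\<close> is alpha-equivalent to its own renaming by \<open>s0 ^^ k\<close>, which therefore fixes its free names.\<close>
  have s0_k: "(s0 ^^ k) x = x" if "x \<in> A" for x
  proof -
    from that obtain i where i: "i \<in> {1..k}" "x \<in> fnames (P i)" by (auto simp: A_def)
    have "db (enc \<circ> s0 ^^ k) (P i) = db enc (P i)" using db_pow[OF i(1), of enc k] sigma_k[OF i(1)] by simp
    from db_eqD[OF this i(2)] show ?thesis using inj_enc by (simp add: inj_eq)
  qed
  have s0_A: "s0 x \<in> A" if "x \<in> A" for x
  proof -
    from that obtain i where i: "i \<in> {1..k}" "x \<in> fnames (P i)" by (auto simp: A_def)
    have "enc ` fnames (P (\<sigma>N i)) = enc ` s0 ` fnames (P i)"
      using db_step[OF i(1), of enc] dfn_db by (metis image_comp)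
    then have "fnames (P (\<sigma>N i)) = s0 ` fnames (P i)" using inj_enc inj_image_eq_iff by metis
    with i permutes_in_image[OF permN] show ?thesis by (force simp: A_def)
  qed
  \<comment> \<open>For a single node \<open>s0\<close> fixes \<open>A\<close>, so
    \<open>\<sigma>X\<close> fixes every arc except possibly \<open>Num 1\<close>, on which
    \<open>s0\<close> acts as on a node. Injectivity of \<open>\<sigma>X\<close> then excludes that
    this one arc is moved.\<close>
  have "k \<noteq> 1"
  proof
    assume k: "k = 1"
    then have "\<sigma>N = id" using permN by (simp add: permutes_sing)
    have fixed: "\<sigma>X x = x" if "x \<in> A - {Obs}" "x \<noteq> Num 1" for x
      using s0_k[of x] that k permutes_not_in[OF permX, of x] by (auto simp: s0_def sig_name_def arcs split: name.splits if_splits)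
    have "\<sigma>X x = x" for x
    proof (cases "x \<in> hg_arcs k P")
      case True
      show ?thesis
      proof (rule ccontr)
        assume ne: "\<sigma>X x \<noteq> x"
        with fixed True have "x = Num 1" by (auto simp: arcs)
        moreover have "\<sigma>X x \<in> hg_arcs k P" using True permutes_in_image[OF permX] by blast
        ultimately have "\<sigma>X (\<sigma>X x) = \<sigma>X x" using ne fixed by (auto simp: arcs)
        with permutes_inj[OF permX] ne show False by (metis injD)
      qed
    qed (simp add: permutes_not_in[OF permX])
    with \<open>\<sigma>N = id\<close> assms(2) show False by auto
  qed
  with k0 have k2: "2 \<le> k" by simp
  \<comment> \<open>Beyond \<open>N\<close> no name occurs in the network, so rotating blocks there
    leaves the action on \<open>A\<close> unchanged.\<close>
  have "finite (Nm -` A)" by (rule finite_vimageI) (auto simp: A_def finite_fnames inj_def)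
  then obtain N where N: "\<And>n. N \<le> n \<Longrightarrow> Nm n \<notin> A"
    by (metis finite_nat_set_iff_bounded leD vimageI)
  define s where "s = block_rotation N k s0"
  have s_s0: "s x = s0 x" if "x \<notin> Nm ` {N..}" for x
    using that by (auto simp: s_def block_rotation_def split: name.split)
  have A_small: "x \<notin> Nm ` {N..}" if "x \<in> A" for x using that N by auto
  have s_pow_A: "(s ^^ m) x = (s0 ^^ m) x \<and> (s ^^ m) x \<in> A" if "x \<in> A" for x m
    using that by (induction m) (auto simp: s_s0 A_small s0_A)
  have s_pow_Num: "(s ^^ m) (Num n) = Num ((\<sigma>N ^^ m) n)" if "n \<in> {1..k}" for m n
  proof (induction m)
    case (Suc m)
    have "s (Num ((\<sigma>N ^^ m) n)) = s0 (Num ((\<sigma>N ^^ m) n))" by (rule s_s0) auto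
    with Suc s0_Num[OF sigma_in[OF that]] show ?case by simp
  qed simp
  have s_pow_big: "(s ^^ t) (Nm (N + k * q + j mod k)) = Nm (N + k * q + (j + t) mod k)" for t q j
    unfolding s_def using k2 by (intro block_rotation_pow) simp
  have "(s ^^ k) x = x" for x
  proof -
    \<comment> \<open>A name occurs in the network, is a node identifier, lies in the rotated range,
      or is fixed by \<open>s\<close>.\<close>
    consider "x \<in> A" | n where "n \<in> {1..k}" "x = Num n" | n where "N \<le> n" "x = Nm n"
      | "x \<notin> A" "x \<notin> Num ` {1..k}" "x \<notin> Nm ` {N..}" by (metis atLeast_iff imageE)
    then show ?thesis
    proof cases
      case 1 then show ?thesis using s_pow_A s0_k by simp
    next
      case 2 then show ?thesis using s_pow_Num sigma_k by simp
    next
      case 3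
      then have "x = Nm (N + k * ((n - N) div k) + (n - N) mod k)" by (simp add: add.assoc)
      then show ?thesis using s_pow_big[of k "(n - N) div k" "n - N"] by simp
    next
      case 4
      then show ?thesis using s_s0 s0_other by (intro funpow_fix) simp
    qed
  qed
  then have s_pow: "s ^^ k = id" by (simp add: fun_eq_iff)
  interpret ring_symmetry k s \<nu>
  proof
    show "s Obs = Obs" using s_s0[of Obs] s0_Obs by auto
    show "s (Num (\<nu> m)) = Num (\<nu> (Suc m))" for m
      using s_s0[of "Num (\<nu> m)"] s0_Num[OF nu_in] by (auto simp: \<nu>_def)
    show "\<exists>y. \<forall>t. (s ^^ t) y \<notin> F \<and> ((s ^^ t) y = y \<longrightarrow> t mod k = 0)" if "finite F" for F
    proof -
      have "finite (Nm -` F)" using that by (rule finite_vimageI) (simp add: inj_def)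
      then obtain B where B: "\<And>n. B \<le> n \<Longrightarrow> Nm n \<notin> F"
        by (metis finite_nat_set_iff_bounded leD vimageI)
      \<comment> \<open>The block with number \<open>B\<close> starts at \<open>N + k * B\<close>,
        hence lies beyond every name in \<open>F\<close>.\<close>
      have "B \<le> k * B" using k2 by (cases k) auto
      then have "Nm (N + k * B + t mod k) \<notin> F" for t by (intro B) (simp add: add.assoc trans_le_add1 trans_le_add2)
      then have "(s ^^ t) (Nm (N + k * B)) \<notin> F \<and> ((s ^^ t) (Nm (N + k * B)) = Nm (N + k * B) \<longrightarrow> t mod k = 0)" for t
        using s_pow_big[of t B 0] by simp
      then show ?thesis by blast
    qed
  qed (use k2 s_pow nu_in nu_eq nu_surj in auto)
  have "csym P"
  proof (rule csymI[of P 0])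
    fix m
    have "x \<in> A" if "x \<in> fnames (P 1)" for x using that k0 by (force simp: A_def)
    then have "db (enc \<circ> s0 ^^ m) (P 1) = db (enc \<circ> s ^^ m) (P 1)"
      by (intro db_cong) (simp add: s_pow_A)
    then show "sem enc (P (\<nu> (0 + m))) = sem (enc \<circ> s ^^ m) (P 1)"
      using db_pow[of 1 enc m] k0 by (simp add: sem_def \<nu>_def)
  qed
  then show ?thesis by (rule not_electoral)
qed

end
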